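(* If $f(x)=\sum_{i\ge 0} f_i x^i$ and $g(x)=\sum_{i\ge 0} g_i x^i$ with $g_0\neq 0$, then the content series $\Phi^{fg^{-1}(x)}=\Phi^{fg^{-1}(x)}(y,z,\mathbf{p})$ is the unique solution to the partial differential equation $$\Big(\sum_{i\ge 0} f_i y^i\,\mathcal{U}_i\Big)\Phi^{fg^{-1}(x)} \;=\; z^{-1}\Big(\sum_{i\ge 0} g_i y^i\,\mathcal{C}_i\Big)\Phi^{fg^{-1}(x)}$$ that satisfies the initial condition $\Phi^{fg^{-1}(x)}(y,0,\mathbf{p})=1$.
   Context: $\mathbf p=(p_1,p_2,\ldots)$ are the power sum symmetric functions, and $p_\alpha=p_{\alpha_1}p_{\alpha_2}\cdots$ for a partition $\alpha$. The Schur function is $s_\lambda=s_\lambda(\mathbf p)=\sum_{\alpha\vdash n}\frac{|\mathcal C_\alpha|}{n!}\chi^\lambda_\alpha p_\alpha$ for $\lambda\vdash n$, where $\mathcal C_\alpha$ is the conjugacy class of cycle type $\alpha$ in the symmetric group $\mathcal S_n$ and $\chi^\lambda_\alpha$ is the value of the irreducible character $\chi^\lambda$ of $\mathcal S_n$ on $\mathcal C_\alpha$. The content of a cell $\Box$ in row $i$ and column $j$ of the diagram of a partition is $c(\Box)=j-i$; $\Box\in\lambda$ means that $\Box$ is a cell of the diagram of $\lambda$. The notation $\mu=\lambda+\Box$ means that $\lambda,\mu$ are partitions and the diagram of $\mu$ is that of $\lambda$ with the single cell $\Box$ added. For a formal power series $f(x)$, the content series is $$\Phi^{f(x)}(y,z,\mathbf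 p)=\sum_{n\ge 0}\frac{z^n}{n!}\sum_{\lambda\vdash n}\chi^\lambda_{(1^n)}\,s_\lambda(\mathbf p)\prod_{\Box\in\lambda}f(y\,c(\Box)),$$ and $\Phi^{fg^{-1}(x)}$ is the content series for the formal power series $f(x)g(x)^{-1}$. For $k\ge 0$, the linear operators $\mathcal U_k$ and $\mathcal C_k$ on symmetric functions (extended linearly over power series in $y,z$) are defined by $$\mathcal U_k\,s_\lambda=\sum_{\Box:\ \mu=\lambda+\Box}c(\Box)^k s_\mu,\qquad \mathcal C_k\,s_\mu=\Big(\frac{n}{\chi^\mu_{(1^n)}}\sum_{\Box:\ \mu=\lambda+\Box}c(\Box)^k\chi^\lambda_{(1^{n-1})}\Big)s_\mu\quad(\mu\vdash n),$$ where the first sum is over all ways to add a cell to $\lambda$ and the second is over all ways to remove a cell from $\mu$, and $0^0=1$. The operators $\mathcal U_k$ and $\mathcal C_k$ can be realized as partial differential operators in $p_1,p_2,\ldots$, which is why the equation is called a partial differential equation.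
   Formalization: Uniqueness is claimed only among series whose coefficient of z^n, for every n>0, has no constant term in p (true of the content series). Without this it fails: (1+z)Φ solves the same equation with the same initial condition. *)

theory Defs
  imports
    "HOL-Library.Poly_Mapping"
    "HOL-Library.Multiset"
    "HOL-Combinatorics.Combinatorics"
    "HOL-Computational_Algebra.Formal_Laurent_Series"
begin

section \<open>Partitions, cells and contents\<close>

definition Partitions :: "nat list set" where
  "Partitions = {\<nu>. sorted_wrt (\<ge>) \<nu> \<and> 0 \<notin> set \<nu>}"

definition partitions_of :: "nat \<Rightarrow> nat list set" where
  "partitions_of n = {\<nu> \<in> Partitions. sum_list \<nu> = n}"

text \<open>Rows and columns are numbered from 0, which does not affect contents.\<close>

definition diagram :: "nat list \<Rightarrow> (nat \<times> nat) set" where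
  "diagram \<nu> = {(i, j). i < length \<nu> \<and> j < \<nu> ! i}"

definition content :: "nat \<times> nat \<Rightarrow> int" where
  "content b = int (snd b) - int (fst b)"

definition adds_cell :: "nat list \<Rightarrow> nat \<times> nat \<Rightarrow> nat list \<Rightarrow> bool" where
  "adds_cell \<nu> b \<mu> \<longleftrightarrow> \<nu> \<in> Partitions \<and> \<mu> \<in> Partitions \<and>
     b \<notin> diagram \<nu> \<and> diagram \<mu> = insert b (diagram \<nu>)"


section \<open>Conjugacy classes of the symmetric groups\<close>

text \<open>The symmetric group on \<open>n\<close> letters consists of the \<open>\<pi>\<close> with \<open>\<pi> permutes {..<n}\<close>.\<close>

definition cycle_type :: "nat \<Rightarrow> (nat \<Rightarrow> nat) \<Rightarrow> nat multiset" where
  "cycle_type n \<pi> = image_mset card (mset_set (orbit \<pi> ` {..<n}))"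

definition conj_class :: "nat list \<Rightarrow> (nat \<Rightarrow> nat) set" where
  "conj_class \<alpha> = {\<pi>. \<pi> permutes {..<sum_list \<alpha>} \<and> cycle_type (sum_list \<alpha>) \<pi> = mset \<alpha>}"


section \<open>Free vector spaces and traces\<close>

definition pm_scale :: "'a::field \<Rightarrow> ('k \<Rightarrow>\<^sub>0 'a) \<Rightarrow> ('k \<Rightarrow>\<^sub>0 'a)" where
  "pm_scale c v = Poly_Mapping.map ((*) c) v"

text \<open>The trace of a linear map \<open>T\<close> on a finite-dimensional \<open>T\<close>-invariant subspace \<open>V\<close>,
  computed in a basis of \<open>V\<close>; its value does not depend on the basis chosen.\<close>

definition trace_on :: "('k \<Rightarrow>\<^sub>0 'a::field) set \<Rightarrow> (('k \<Rightarrow>\<^sub>0 'a) \<Rightarrow> ('k \<Rightarrow>\<^sub>0 'a)) \<Rightarrow> 'a" where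
  "trace_on V T =
     (let B = (SOME B. \<not> module.dependent pm_scale B \<and> module.span pm_scale B = V)
      in \<Sum>b\<in>B. module.representation pm_scale B (T b) b)"


section \<open>Irreducible characters of the symmetric groups\<close>

text \<open>\<open>\<chi>\<^sup>\<nu>\<close> is the character of the Specht module of shape \<open>\<nu>\<close>, the standard model
  of the irreducible representation indexed by \<open>\<nu>\<close>. The field \<open>'a\<close> is any field of
  characteristic 0.

  A tableau is a bijective filling of the diagram with \<open>0, \<dots>, n - 1\<close> (its values off the
  diagram are irrelevant), and a tabloid is the function giving the set of entries of each row.\<close>

type_synonym tabloid = "nat \<Rightarrow> nat set"

definition tableaux :: "nat list \<Rightarrow> (nat \<times> nat \<Rightarrow> nat) set" where
  "tableaux \<nu> = {t. bij_betw t (diagram \<nu>) {..<sum_list \<nu>}}"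

definition tabloid_of :: "nat list \<Rightarrow> (nat \<times> nat \<Rightarrow> nat) \<Rightarrow> tabloid" where
  "tabloid_of \<nu> t = (\<lambda>i. t ` {b \<in> diagram \<nu>. fst b = i})"

definition perm_tabloid :: "(nat \<Rightarrow> nat) \<Rightarrow> tabloid \<Rightarrow> tabloid" where
  "perm_tabloid \<pi> T = (\<lambda>i. \<pi> ` T i)"

definition perm_action :: "(nat \<Rightarrow> nat) \<Rightarrow> (tabloid \<Rightarrow>\<^sub>0 'a::field) \<Rightarrow> (tabloid \<Rightarrow>\<^sub>0 'a)" where
  "perm_action \<pi> v =
     (\<Sum>T\<in>Poly_Mapping.keys v. Poly_Mapping.single (perm_tabloid \<pi> T) (Poly_Mapping.lookup v T))"

definition column_stabilizer :: "nat list \<Rightarrow> (nat \<times> nat \<Rightarrow> nat) \<Rightarrow> (nat \<Rightarrow> nat) set" where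
  "column_stabilizer \<nu> t =
     {\<sigma>. \<sigma> permutes {..<sum_list \<nu>} \<and>
          (\<forall>j. \<sigma> ` t ` {b \<in> diagram \<nu>. snd b = j} = t ` {b \<in> diagram \<nu>. snd b = j})}"

definition polytabloid :: "nat list \<Rightarrow> (nat \<times> nat \<Rightarrow> nat) \<Rightarrow> (tabloid \<Rightarrow>\<^sub>0 'a::field)" where
  "polytabloid \<nu> t =
     (\<Sum>\<sigma>\<in>column_stabilizer \<nu> t.
        Poly_Mapping.single (perm_tabloid \<sigma> (tabloid_of \<nu> t)) (of_int (sign \<sigma>)))"

definition specht :: "nat list \<Rightarrow> (tabloid \<Rightarrow>\<^sub>0 'a::field) set" where
  "specht \<nu> = module.span pm_scale (polytabloid \<nu> ` tableaux \<nu>)"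

definition irr_char :: "nat list \<Rightarrow> (nat \<Rightarrow> nat) \<Rightarrow> 'a::field_char_0" where
  "irr_char \<nu> \<pi> = trace_on (specht \<nu>) (perm_action \<pi>)"

definition char_value :: "nat list \<Rightarrow> nat list \<Rightarrow> 'a::field_char_0" where
  "char_value \<nu> \<alpha> = irr_char \<nu> (SOME \<pi>. \<pi> \<in> conj_class \<alpha>)"

text \<open>\<open>\<chi>\<^sup>\<nu>\<close> on the class of cycle type \<open>(1\<^sup>n)\<close>, where \<open>n\<close> is the size of \<open>\<nu>\<close>.\<close>

definition char_deg :: "nat list \<Rightarrow> 'a::field_char_0" where
  "char_deg \<nu> = char_value \<nu> (replicate (sum_list \<nu>) 1)"


section \<open>Symmetric functions as polynomials in the power sums\<close>

text \<open>Over a field of characteristic 0 the ring of symmetric functions is the polynomial ring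
  in the algebraically independent power sums \<open>p\<^sub>1, p\<^sub>2, \<dots>\<close>. Monomials are exponent
  vectors; since the indices of the variables start at 0, variable \<open>i\<close> is \<open>p\<^bsub>i+1\<^esub>\<close>.\<close>

type_synonym 'a symfun = "(nat \<Rightarrow>\<^sub>0 nat) \<Rightarrow>\<^sub>0 'a"

definition power_sum :: "nat \<Rightarrow> 'a::field_char_0 symfun" where
  "power_sum k = Poly_Mapping.single (Poly_Mapping.single (k - 1) 1) 1"

definition power_sum_part :: "nat list \<Rightarrow> 'a::field_char_0 symfun" where
  "power_sum_part \<alpha> = prod_list (map power_sum \<alpha>)"

definition schur :: "nat list \<Rightarrow> 'a::field_char_0 symfun" where
  "schur \<nu> =
     (\<Sum>\<alpha>\<in>partitions_of (sum_list \<nu>).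
        pm_scale (of_nat (card (conj_class \<alpha>)) / fact (sum_list \<nu>) * char_value \<nu> \<alpha>)
          (power_sum_part \<alpha>))"

text \<open>The Schur functions form a basis, so each of the following two descriptions
  determines exactly one linear operator.\<close>

definition U_op :: "nat \<Rightarrow> 'a::field_char_0 symfun \<Rightarrow> 'a symfun" where
  "U_op k = (THE T. Vector_Spaces.linear pm_scale pm_scale T \<and>
     (\<forall>\<nu>\<in>Partitions.
        T (schur \<nu>) =
          (\<Sum>(b, \<mu>)\<in>{(b, \<mu>). adds_cell \<nu> b \<mu>}. pm_scale (of_int (content b) ^ k) (schur \<mu>))))"

definition C_op :: "nat \<Rightarrow> 'a::field_char_0 symfun \<Rightarrow> 'a symfun" where
  "C_op k = (THE T. Vector_Spaces.linear pm_scale pm_scale T \<and>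
     (\<forall>\<mu>\<in>Partitions.
        T (schur \<mu>) =
          pm_scale
            (of_nat (sum_list \<mu>) / char_deg \<mu> *
              (\<Sum>(b, \<nu>)\<in>{(b, \<nu>). adds_cell \<nu> b \<mu>}. of_int (content b) ^ k * char_deg \<nu>))
            (schur \<mu>)))"


section \<open>Content series\<close>

text \<open>A formal power series in \<open>y\<close> and \<open>z\<close> over the symmetric functions is a series in
  \<open>z\<close> whose coefficients are series in \<open>y\<close>: the coefficient of \<open>y\<^sup>m z\<^sup>n\<close> in \<open>\<Phi>\<close> is
  \<open>\<Phi> $ n $ m\<close>.\<close>

type_synonym 'a symfun_series = "'a symfun fps fps"

definition const_fps :: "'a::field_char_0 fps \<Rightarrow> 'a symfun fps" where
  "const_fps F = Abs_fps (\<lambda>m. Poly_Mapping.single 0 (F $ m))"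

definition content_series :: "'a::field_char_0 fps \<Rightarrow> 'a symfun_series" where
  "content_series h =
     Abs_fps (\<lambda>n. \<Sum>\<nu>\<in>partitions_of n.
       const_fps (fps_const (char_deg \<nu> / fact n) *
                  (\<Prod>b\<in>diagram \<nu>. h oo (fps_const (of_int (content b)) * fps_X))) *
       fps_const (schur \<nu>))"

text \<open>The operator \<open>\<Sum>\<^sub>i f\<^sub>i y\<^sup>i T\<^sub>i\<close>, where the \<open>T\<^sub>i\<close> act coefficientwise on series in
  \<open>y\<close> and \<open>z\<close>: the coefficient of \<open>y\<^sup>m\<close> receives \<open>f\<^sub>i T\<^sub>i\<close> applied to the coefficient
  of \<open>y\<^bsup>m-i\<^esup>\<close>, for all \<open>i \<le> m\<close>.\<close>

definition op_series ::
  "'a::field_char_0 fps \<Rightarrow> (nat \<Rightarrow> 'a symfun \<Rightarrow> 'a symfun) \<Rightarrow> 'a symfun_series \<Rightarrow> 'a symfun_series"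
  where
  "op_series f T \<Psi> =
     Abs_fps (\<lambda>n. Abs_fps (\<lambda>m. \<Sum>i\<le>m. pm_scale (f $ i) (T i (\<Psi> $ n $ (m - i)))))"

text \<open>Because of the factor \<open>z\<^sup>-\<^sup>1\<close> the equation is stated between Laurent series in \<open>z\<close>.\<close>

definition content_pde :: "'a::field_char_0 fps \<Rightarrow> 'a fps \<Rightarrow> 'a symfun_series \<Rightarrow> bool" where
  "content_pde f g \<Psi> \<longleftrightarrow>
     fps_to_fls (op_series f U_op \<Psi>) = fls_X_inv * fps_to_fls (op_series g C_op \<Psi>)"

text \<open>In the content series \<open>z\<close> records the degree in \<open>\<^bold>p\<close>. Of this only the following is
  needed for uniqueness: for \<open>n > 0\<close> the coefficient of \<open>z\<^sup>n\<close> has no constant term as a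
  polynomial in \<open>\<^bold>p\<close>. Some such condition is indispensable, because the solutions of the
  equation with value 1 at \<open>z = 0\<close> are closed under multiplication by series in \<open>z\<close>
  with constant term 1.\<close>

definition const_term_free :: "'a::field_char_0 symfun_series \<Rightarrow> bool" where
  "const_term_free \<Psi> \<longleftrightarrow> (\<forall>n>0. \<forall>m. Poly_Mapping.lookup (\<Psi> $ n $ m) 0 = 0)"

end

theory Submission
  imports Defs
begin

text \<open>Both operator families act simply on Schur functions: \<open>\<Sum>\<^sub>i f\<^sub>i y\<^sup>i U\<^sub>i\<close> sends \<open>s\<^sub>\<nu>\<close> to
\<open>\<Sum> f(y c(b)) s\<^sub>\<mu>\<close>, summed over the cells \<open>b\<close> with \<open>\<mu> = \<nu> + b\<close>, and \<open>\<Sum>\<^sub>i g\<^sub>i y\<^sup>i C\<^sub>i\<close>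
multiplies \<open>s\<^sub>\<mu>\<close>, \<open>\<mu>\<close> of size \<open>n\<close>, by \<open>n / \<chi>\<^sup>\<mu>(1) \<cdot> \<Sum> g(y c(b)) \<chi>\<^sup>\<nu>(1)\<close>, summed over the removable cells. Write
\<open>h = f / g\<close> and let \<open>w\<^sub>\<nu> = \<chi>\<^sup>\<nu>(1) / |\<nu>|! \<cdot> \<Prod> h(y c(b))\<close> be the coefficient of \<open>s\<^sub>\<nu>\<close> in the
content series. If \<open>\<mu> = \<nu> + b\<close> has size \<open>n\<close>, then
\<open>(n \<chi>\<^sup>\<nu>(1) / \<chi>\<^sup>\<mu>(1)) g(y c(b)) w\<^sub>\<mu> = f(y c(b)) w\<^sub>\<nu>\<close>, because the degrees and factorials cancel and \<open>g h = f\<close> turns the factor of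
\<open>w\<^sub>\<mu>\<close> at the new cell into \<open>f(y c(b))\<close> (lemma \<open>content_weight_step\<close>). Hence the two sides of the
equation agree term by term over the pairs \<open>\<nu> \<subset> \<mu>\<close>.

For uniqueness, the equation expresses \<open>\<Sum>\<^sub>i g\<^sub>i y\<^sup>i C\<^sub>i\<close> applied to the coefficient of
\<open>z\<^bsup>n+1\<^esup>\<close> through the coefficient of \<open>z\<^sup>n\<close>. Its lowest term in \<open>y\<close> is \<open>g\<^sub>0 C\<^sub>0\<close>, and \<open>C\<^sub>0\<close> is
diagonal on the Schur basis. Its eigenvalue at \<open>s\<^sub>\<mu>\<close> is \<open>n\<close> times a quotient of positive sums of
dimensions, nonzero except at \<open>s\<^bsub>[]\<^esub> = 1\<close>. So \<open>C\<^sub>0\<close> is injective on the polynomials without constant term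
(\<open>C_op_0_injective\<close>), and a recursion on the exponent of \<open>z\<close>, and for each of these on the exponent
of \<open>y\<close>, determines the solution from its value at \<open>z = 0\<close>.

The main work is to show that the Schur functions, defined through traces on
Specht modules, form a basis of the polynomials in the power sums; only then are \<open>U\<^sub>k\<close> and \<open>C\<^sub>k\<close>
well defined. As there are as many Schur functions of degree \<open>n\<close> as
monomials \<open>p\<^sub>\<alpha>\<close> with \<open>\<alpha>\<close> a partition of \<open>n\<close>, it suffices that the Specht characters are linearly
independent. Fix a tableau \<open>t\<close> of shape \<open>\<kappa>\<close> and let the signed sum of its column stabilizer act on the module of
tabloids of shape \<open>\<mu>\<close>. It kills a tabloid as soon as two entries share a row of the tabloid and a
column of \<open>t\<close>; hence it is zero unless \<open>\<kappa>\<close> dominates \<open>\<mu>\<close>, and for \<open>\<mu> = \<kappa>\<close> its image is the line spanned by the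
polytabloid of \<open>t\<close>. The trace of this element is therefore zero on the Specht module of shape \<open>\<mu>\<close> unless \<open>\<kappa>\<close>
dominates \<open>\<mu>\<close>, and it is the order of the column stabilizer if \<open>\<mu> = \<kappa>\<close>. The resulting matrix
is triangular with nonzero diagonal (\<open>irr_chars_independent\<close>). Passing from permutations to cycle types
uses that permutations with the same cycle type are conjugate and that every cycle type occurs.\<close>

section \<open>Free vector spaces and traces\<close>

lemma lookup_pm_scale [simp]: "Poly_Mapping.lookup (pm_scale c v) k = c * Poly_Mapping.lookup v k"
  by (simp add: pm_scale_def map.rep_eq when_def)

lemma pm_scale_eq_mult: "pm_scale c v = Poly_Mapping.single 0 c * v"
  unfolding pm_scale_def by (rule mult_map_scale_conv_mult)

lemma pm_scale_single [simp]: "pm_scale c (Poly_Mapping.single k a) = Poly_Mapping.single k (c * a)"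
  by (rule poly_mapping_eqI) (simp add: lookup_single when_def)

interpretation pm: vector_space "pm_scale :: 'a::field \<Rightarrow> ('k \<Rightarrow>\<^sub>0 'a) \<Rightarrow> ('k \<Rightarrow>\<^sub>0 'a)"
  by unfold_locales (auto intro!: poly_mapping_eqI simp: lookup_add algebra_simps)

interpretation pmp: vector_space_pair
  "pm_scale :: 'a::field \<Rightarrow> ('k \<Rightarrow>\<^sub>0 'a) \<Rightarrow> ('k \<Rightarrow>\<^sub>0 'a)"
  "pm_scale :: 'a::field \<Rightarrow> ('l \<Rightarrow>\<^sub>0 'a) \<Rightarrow> ('l \<Rightarrow>\<^sub>0 'a)"
  by unfold_locales

abbreviation pm_linear :: "(('k \<Rightarrow>\<^sub>0 'a::field) \<Rightarrow> ('l \<Rightarrow>\<^sub>0 'a)) \<Rightarrow> bool" where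
  "pm_linear \<equiv> Vector_Spaces.linear pm_scale pm_scale"

lemma pm_linearI:
  assumes "\<And>v w. T (v + w) = T v + T w" "\<And>c v. T (pm_scale c v) = pm_scale c (T v)"
  shows "pm_linear T"
  by unfold_locales (use assms in auto)

lemma poly_mapping_sum_singles:
  "(\<Sum>k\<in>Poly_Mapping.keys v. Poly_Mapping.single k (Poly_Mapping.lookup v k)) = v"
  by (rule poly_mapping_eqI)
     (auto simp: lookup_sum lookup_single when_def in_keys_iff)

definition finite_dim :: "('k \<Rightarrow>\<^sub>0 'a::field) set \<Rightarrow> bool" where
  "finite_dim V \<longleftrightarrow> pm.subspace V \<and> (\<exists>S. finite S \<and> V \<subseteq> pm.span S)"

text \<open>The basis hidden in the definition of \<open>trace_on\<close>. It depends on the space only, which makes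
the trace linear in the operator.\<close>

definition chosen_basis :: "('k \<Rightarrow>\<^sub>0 'a::field) set \<Rightarrow> ('k \<Rightarrow>\<^sub>0 'a) set" where
  "chosen_basis V = (SOME B. pm.independent B \<and> pm.span B = V)"

lemma chosen_basis:
  assumes "finite_dim V"
  shows "pm.independent (chosen_basis V)" "pm.span (chosen_basis V) = V" "finite (chosen_basis V)"
proof -
  have V: "pm.subspace V" using assms by (simp add: finite_dim_def)
  obtain B where "B \<subseteq> V" "pm.independent B" "V \<subseteq> pm.span B"
    by (rule pm.maximal_independent_subset)
  then have "pm.independent B \<and> pm.span B = V"
    using V pm.span_subspace[of B V] by auto
  then have *: "pm.independent (chosen_basis V) \<and> pm.span (chosen_basis V) = V"
    unfolding chosen_basis_def by (rule someI)
  then show "pm.independent (chosen_basis V)" "pm.span (chosen_basis V) = V" by auto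
  obtain S where "finite S" "V \<subseteq> pm.span S" using assms by (auto simp: finite_dim_def)
  then show "finite (chosen_basis V)"
    using * pm.span_superset[of "chosen_basis V"]
      pm.independent_span_bound[of S "chosen_basis V"] by simp
qed

lemma trace_on_eq:
  "trace_on V T = (\<Sum>b\<in>chosen_basis V. pm.representation (chosen_basis V) (T b) b)"
  by (simp add: trace_on_def chosen_basis_def Let_def)

lemma chosen_basis_subset: "finite_dim V \<Longrightarrow> b \<in> chosen_basis V \<Longrightarrow> b \<in> V"
  using chosen_basis(2) pm.span_base by blast

lemma trace_on_cong:
  assumes "finite_dim V" "\<And>v. v \<in> V \<Longrightarrow> S v = T v"
  shows "trace_on V S = trace_on V T"
  unfolding trace_on_eq using assms by (auto intro!: sum.cong simp: chosen_basis_subset)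

lemma trace_on_sum:
  assumes V: "finite_dim V" and T: "\<And>i v. i \<in> I \<Longrightarrow> v \<in> V \<Longrightarrow> T i v \<in> V"
  shows "trace_on V (\<lambda>v. \<Sum>i\<in>I. pm_scale (c i) (T i v)) = (\<Sum>i\<in>I. c i * trace_on V (T i))"
proof -
  let ?B = "chosen_basis V"
  note B = chosen_basis[OF V]
  have "pm.representation ?B (\<Sum>i\<in>I. pm_scale (c i) (T i b)) b
      = (\<Sum>i\<in>I. c i * pm.representation ?B (T i b) b)" if b: "b \<in> ?B" for b
    using B T chosen_basis_subset[OF V b]
    using pm.subspace_scale[of V] V
    by (subst pm.representation_sum) (auto simp: pm.representation_scale finite_dim_def)
  then show ?thesis
    by (simp add: trace_on_eq sum_distrib_left sum.swap[of _ I])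
qed

lemma trace_on_zero: "trace_on V (\<lambda>_. 0) = 0"
  by (simp add: trace_on_eq pm.representation_zero)

lemma trace_on_id:
  assumes "finite_dim V"
  shows "trace_on V (\<lambda>v. v) = of_nat (card (chosen_basis V))"
  using chosen_basis[OF assms] by (simp add: trace_on_eq pm.representation_basis)

lemma representation_linear_expand:
  assumes V: "finite_dim V" and lin: "pm_linear T" and T: "\<And>v. v \<in> V \<Longrightarrow> T v \<in> V" and v: "v \<in> V"
  shows "pm.representation (chosen_basis V) (T v) k =
    (\<Sum>b\<in>chosen_basis V. pm.representation (chosen_basis V) v b *
        pm.representation (chosen_basis V) (T b) k)"
proof -
  let ?B = "chosen_basis V"
  note B = chosen_basis[OF V]
  have "T v = T (\<Sum>b\<in>?B. pm_scale (pm.representation ?B v b) b)"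
    using B v by (simp add: pm.sum_representation_eq)
  also have "\<dots> = (\<Sum>b\<in>?B. pm_scale (pm.representation ?B v b) (T b))"
    by (simp add: pmp.linear_sum[OF lin] pmp.linear_scale[OF lin])
  finally have expand: "T v = (\<Sum>b\<in>?B. pm_scale (pm.representation ?B v b) (T b))" .
  show ?thesis
    using B T chosen_basis_subset[OF V] pm.subspace_scale[of V] V
    by (subst expand, subst pm.representation_sum)
       (auto simp: pm.representation_scale finite_dim_def)
qed

text \<open>In a basis this is the symmetry of \<open>\<Sum>\<^sub>b \<Sum>\<^sub>c T\<^bsub>cb\<^esub> S\<^bsub>bc\<^esub>\<close>. As \<open>trace_on\<close> refers to one fixed
basis, this commutation replaces invariance under a change of basis; it is what makes characters
class functions.\<close>

lemma trace_on_commute: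
  assumes V: "finite_dim V"
    and S: "pm_linear S" "\<And>v. v \<in> V \<Longrightarrow> S v \<in> V"
    and T: "pm_linear T" "\<And>v. v \<in> V \<Longrightarrow> T v \<in> V"
  shows "trace_on V (\<lambda>v. S (T v)) = trace_on V (\<lambda>v. T (S v))"
proof -
  let ?B = "chosen_basis V"
  let ?r = "pm.representation ?B"
  have "trace_on V (\<lambda>v. S (T v)) = (\<Sum>b\<in>?B. \<Sum>c\<in>?B. ?r (T b) c * ?r (S c) b)"
    unfolding trace_on_eq using assms chosen_basis_subset[OF V]
    by (intro sum.cong refl representation_linear_expand) auto
  also have "\<dots> = (\<Sum>c\<in>?B. \<Sum>b\<in>?B. ?r (S c) b * ?r (T b) c)"
    by (subst sum.swap) (simp add: mult.commute)
  also have "\<dots> = trace_on V (\<lambda>v. T (S v))"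
    unfolding trace_on_eq using assms chosen_basis_subset[OF V]
    by (intro sum.cong refl representation_linear_expand[symmetric]) auto
  finally show ?thesis .
qed

text \<open>An operator with image in the line of \<open>e\<close> has the form \<open>v \<mapsto> \<phi>(v) e\<close>, and its trace is
\<open>\<Sum>\<^sub>b \<phi>(b) e\<^sub>b = \<phi>(e)\<close>. The functional \<open>\<phi>\<close> is read off at a coordinate \<open>k\<close> where \<open>e\<close> is 1.\<close>

lemma trace_on_rank_one:
  assumes V: "finite_dim V" and lin: "pm_linear T" and e: "e \<in> V"
    and ek: "Poly_Mapping.lookup e k = 1"
    and T: "\<And>v. v \<in> V \<Longrightarrow> T v = pm_scale (Poly_Mapping.lookup (T v) k) e"
  shows "trace_on V T = Poly_Mapping.lookup (T e) k"
proof -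
  let ?B = "chosen_basis V"
  let ?r = "pm.representation ?B"
  note B = chosen_basis[OF V]
  have "T e = T (\<Sum>b\<in>?B. pm_scale (?r e b) b)"
    using B e by (simp add: pm.sum_representation_eq)
  also have "\<dots> = (\<Sum>b\<in>?B. pm_scale (?r e b) (T b))"
    by (simp add: pmp.linear_sum[OF lin] pmp.linear_scale[OF lin])
  finally have "Poly_Mapping.lookup (T e) k = (\<Sum>b\<in>?B. ?r e b * Poly_Mapping.lookup (T b) k)"
    by (simp add: lookup_sum)
  also have "\<dots> = (\<Sum>b\<in>?B. ?r (T b) b)"
  proof (rule sum.cong [OF refl])
    fix b assume b: "b \<in> ?B"
    have "?r (T b) b = ?r (pm_scale (Poly_Mapping.lookup (T b) k) e) b"
      using T[OF chosen_basis_subset[OF V b]] by simp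
    also have "\<dots> = ?r e b * Poly_Mapping.lookup (T b) k"
      using B e by (simp add: pm.representation_scale)
    finally show "?r e b * Poly_Mapping.lookup (T b) k = ?r (T b) b" by simp
  qed
  finally show ?thesis by (simp add: trace_on_eq)
qed

section \<open>Cycle types and conjugacy\<close>

lemma permutes_finite_permutation: "f permutes {..<n::nat} \<Longrightarrow> permutation f"
  by (auto simp: permutation_permutes)

lemma funpow_eq_iff_mod_card_orbit:
  assumes "permutation f"
  shows "(f ^^ i) x = (f ^^ j) x \<longleftrightarrow> i mod card (orbit f x) = j mod card (orbit f x)"
proof -
  have x: "x \<in> orbit f x" using assms by (rule permutation_self_in_orbit)
  let ?p = "funpow_dist1 f x x"
  have inj: "inj_on (\<lambda>n. (f ^^ n) x) {0..<?p}" by (rule inj_on_funpow_dist1[OF x])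
  have p: "(f ^^ ?p) x = x" by (rule funpow_dist1_prop[OF x])
  have card: "card (orbit f x) = ?p"
    by (subst orbit_conv_funpow_dist1[OF x]) (simp add: card_image[OF inj])
  have "(f ^^ i) x = (f ^^ j) x \<longleftrightarrow> (f ^^ (i mod ?p)) x = (f ^^ (j mod ?p)) x"
    by (metis funpow_mod_eq[OF p])
  also have "\<dots> \<longleftrightarrow> i mod ?p = j mod ?p"
    using inj by (rule inj_on_eq_iff) auto
  finally show ?thesis by (simp only: card)
qed

lemma count_cycle_type:
  "count (cycle_type n \<pi>) k = card {A \<in> orbit \<pi> ` {..<n}. card A = k}"
  unfolding cycle_type_def count_image_mset'
  by (simp add: eq_commute[of k])

text \<open>Equal cycle types mean equally many orbits of each size \<open>k\<close>; bijections for the separate \<open>k\<close>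
are glued together.\<close>

lemma orbit_matching:
  assumes "cycle_type n \<pi> = cycle_type n \<sigma>"
  obtains F where "bij_betw F (orbit \<pi> ` {..<n}) (orbit \<sigma> ` {..<n})"
    "\<And>A. A \<in> orbit \<pi> ` {..<n} \<Longrightarrow> card (F A) = card A"
proof -
  let ?O = "\<lambda>k. {A \<in> orbit \<pi> ` {..<n}. card A = k}"
  let ?P = "\<lambda>k. {A \<in> orbit \<sigma> ` {..<n}. card A = k}"
  have "\<exists>F. bij_betw F (?O k) (?P k)" for k
  proof (rule finite_same_card_bij)
    show "card (?O k) = card (?P k)"
      unfolding count_cycle_type[symmetric] assms ..
  qed auto
  then have "\<forall>k. \<exists>F. bij_betw F (?O k) (?P k)" ..
  from choice[OF this] obtain F where F: "\<And>k. bij_betw (F k) (?O k) (?P k)" by blast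
  let ?G = "\<lambda>A. F (card A) A"
  have G: "?G A \<in> ?P (card A)" if "A \<in> orbit \<pi> ` {..<n}" for A
    using bij_betwE[OF F[of "card A"]] that by auto
  have "bij_betw ?G (orbit \<pi> ` {..<n}) (orbit \<sigma> ` {..<n})"
  proof (rule bij_betwI')
    fix A B assume AB: "A \<in> orbit \<pi> ` {..<n}" "B \<in> orbit \<pi> ` {..<n}"
    show "?G A = ?G B \<longleftrightarrow> A = B"
    proof
      assume eq: "?G A = ?G B"
      then have "card A = card B" using G[OF AB(1)] G[OF AB(2)] by simp
      then show "A = B"
        using eq AB bij_betw_imp_inj_on[OF F[of "card B"]] by (auto dest: inj_onD)
    qed simp
  next
    fix A assume "A \<in> orbit \<pi> ` {..<n}"
    then show "?G A \<in> orbit \<sigma> ` {..<n}" using G by blast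
  next
    fix B assume "B \<in> orbit \<sigma> ` {..<n}"
    then have "B \<in> F (card B) ` ?O (card B)"
      using bij_betw_imp_surj_on[OF F[of "card B"]] by auto
    then obtain A where "A \<in> ?O (card B)" "B = F (card B) A" by blast
    then show "\<exists>A\<in>orbit \<pi> ` {..<n}. B = ?G A" by (intro bexI[of _ A]) simp_all
  qed
  with G show ?thesis by (intro that[of ?G]) auto
qed

text \<open>Match the orbits of \<open>\<pi>\<close> with orbits of \<open>\<sigma>\<close> of the same size, choose a base point in each, and
send the \<open>i\<close>-th iterate of \<open>\<pi>\<close> at a base point to the \<open>i\<close>-th iterate of \<open>\<sigma>\<close> at the matching
one. Since the iterates depend on \<open>i\<close> only modulo the common orbit size, this is well defined,
injective and intertwines \<open>\<pi>\<close> and \<open>\<sigma>\<close>.\<close>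

lemma cycle_type_eq_imp_conjugate:
  assumes \<pi>: "\<pi> permutes {..<n}" and \<sigma>: "\<sigma> permutes {..<n}"
    and ct: "cycle_type n \<pi> = cycle_type n \<sigma>"
  obtains \<tau> where "\<tau> permutes {..<n}" "\<tau> \<circ> \<pi> = \<sigma> \<circ> \<tau>"
proof -
  have p\<pi>: "permutation \<pi>" and p\<sigma>: "permutation \<sigma>"
    using \<pi> \<sigma> by (auto intro: permutes_finite_permutation)
  obtain F where F: "bij_betw F (orbit \<pi> ` {..<n}) (orbit \<sigma> ` {..<n})"
    and card: "\<And>A. A \<in> orbit \<pi> ` {..<n} \<Longrightarrow> card (F A) = card A"
    by (rule orbit_matching[OF ct]) blast
  define a where "a A = (SOME x. x \<in> A)" for A :: "nat set"
  define d where "d x = funpow_dist \<pi> (a (orbit \<pi> x)) x" for x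
  define h where "h x = (\<sigma> ^^ d x) (a (F (orbit \<pi> x)))" for x
  define \<tau> where "\<tau> x = (if x < n then h x else x)" for x
  have a: "a (orbit f x) \<in> orbit f x" for f x
    unfolding a_def using orbit_nonempty some_in_eq by metis
  have orbit_a: "orbit f (a (orbit f x)) = orbit f x" if "permutation f" for f x
    using that a by (metis cyclic_on_orbit' orbit_cyclic_eq3)
  have F_orbit: "orbit \<sigma> (a (F (orbit \<pi> x))) = F (orbit \<pi> x)" if "x < n" for x
  proof -
    have "F (orbit \<pi> x) \<in> orbit \<sigma> ` {..<n}" using bij_betwE[OF F] that by auto
    then show ?thesis using orbit_a[OF p\<sigma>] by auto
  qed
  have d: "(\<pi> ^^ d x) (a (orbit \<pi> x)) = x" for x
    unfolding d_def
    by (rule funpow_dist_prop) (simp add: orbit_a[OF p\<pi>] permutation_self_in_orbit[OF p\<pi>])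
  have orbit_step: "orbit \<pi> (\<pi> x) = orbit \<pi> x" for x
    by (rule permutation_orbit_step[OF p\<pi>])
  have \<pi>_lt: "\<pi> x < n \<longleftrightarrow> x < n" for x using permutes_in_image[OF \<pi>, of x] by simp
  have comm: "h (\<pi> x) = \<sigma> (h x)" if x: "x < n" for x
  proof -
    let ?a = "a (orbit \<pi> x)" and ?b = "a (F (orbit \<pi> x))"
    have "(\<pi> ^^ d (\<pi> x)) ?a = (\<pi> ^^ Suc (d x)) ?a"
      using d[of "\<pi> x"] d[of x] by (simp add: orbit_step)
    then have "d (\<pi> x) mod card (orbit \<pi> x) = Suc (d x) mod card (orbit \<pi> x)"
      by (simp only: funpow_eq_iff_mod_card_orbit[OF p\<pi>] orbit_a[OF p\<pi>])
    then have "(\<sigma> ^^ d (\<pi> x)) ?b = (\<sigma> ^^ Suc (d x)) ?b"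
      using x card[of "orbit \<pi> x"] by (simp only: funpow_eq_iff_mod_card_orbit[OF p\<sigma>] F_orbit) auto
    then show ?thesis by (simp add: h_def orbit_step)
  qed
  have h_in: "h x \<in> F (orbit \<pi> x)" if "x < n" for x
  proof -
    have "h x \<in> orbit \<sigma> (a (F (orbit \<pi> x)))"
      unfolding h_def by (intro funpow_in_orbit permutation_self_in_orbit p\<sigma>)
    then show ?thesis using F_orbit[OF that] by simp
  qed
  have orbit_h: "orbit \<sigma> (h x) = F (orbit \<pi> x)" if "x < n" for x
    using h_in[OF that] F_orbit[OF that] cyclic_on_orbit'[OF p\<sigma>] by (metis orbit_cyclic_eq3)
  have inj: "inj_on h {..<n}"
  proof (rule inj_onI)
    fix x y assume xy: "x \<in> {..<n}" "y \<in> {..<n}" and eq: "h x = h y"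
    then have "F (orbit \<pi> x) = F (orbit \<pi> y)" using orbit_h by (metis lessThan_iff)
    then have o: "orbit \<pi> x = orbit \<pi> y"
      using bij_betw_imp_inj_on[OF F] xy by (auto dest: inj_onD)
    have "(\<sigma> ^^ d x) (a (F (orbit \<pi> x))) = (\<sigma> ^^ d y) (a (F (orbit \<pi> x)))"
      using eq by (simp add: h_def o)
    then have "d x mod card (orbit \<pi> x) = d y mod card (orbit \<pi> x)"
      using xy card[of "orbit \<pi> x"]
      by (simp only: funpow_eq_iff_mod_card_orbit[OF p\<sigma>] F_orbit lessThan_iff) auto
    then have "(\<pi> ^^ d x) (a (orbit \<pi> x)) = (\<pi> ^^ d y) (a (orbit \<pi> x))"
      by (simp only: funpow_eq_iff_mod_card_orbit[OF p\<pi>] orbit_a[OF p\<pi>])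
    then show "x = y" using d[of x] d[of y] o by metis
  qed
  have "h ` {..<n} \<subseteq> {..<n}"
  proof
    fix y assume "y \<in> h ` {..<n}"
    then obtain x where x: "x < n" "y = h x" by auto
    then have "F (orbit \<pi> x) \<in> orbit \<sigma> ` {..<n}" using bij_betwE[OF F] by auto
    then show "y \<in> {..<n}" using h_in x permutes_orbit_subset[OF \<sigma>] by blast
  qed
  then have "bij_betw h {..<n} {..<n}"
    using inj by (simp add: bij_betw_def endo_inj_surj)
  then have "bij_betw \<tau> {..<n} {..<n}"
    by (rule bij_betw_cong[THEN iffD1, rotated]) (simp add: \<tau>_def)
  then have "\<tau> permutes {..<n}" by (rule bij_imp_permutes) (simp add: \<tau>_def)
  moreover have "\<tau> \<circ> \<pi> = \<sigma> \<circ> \<tau>"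
  proof
    fix x show "(\<tau> \<circ> \<pi>) x = (\<sigma> \<circ> \<tau>) x"
      using comm[of x] permutes_not_in[OF \<pi>, of x] permutes_not_in[OF \<sigma>, of x] \<pi>_lt[of x]
      by (auto simp: \<tau>_def)
  qed
  ultimately show ?thesis by (rule that)
qed

text \<open>The parts are added one at a time: given a permutation of \<open>{..<s}\<close> for the remaining parts, a part
\<open>a\<close> becomes a cycle through the interval \<open>{s..<s + a}\<close>.\<close>

lemma conj_class_nonempty:
  assumes "0 \<notin> set \<alpha>"
  shows "conj_class \<alpha> \<noteq> {}"
  using assms
proof (induction \<alpha>)
  case Nil
  have "id \<in> conj_class []" by (simp add: conj_class_def cycle_type_def permutes_id)
  then show ?case by blast
next
  case (Cons a \<alpha>)
  define s where "s = sum_list \<alpha>"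
  have a: "a > 0" using Cons.prems by auto
  obtain \<pi>' where "\<pi>' \<in> conj_class \<alpha>" using Cons by auto
  then have \<pi>': "\<pi>' permutes {..<s}" "cycle_type s \<pi>' = mset \<alpha>"
    by (auto simp: conj_class_def s_def)
  define \<pi> where "\<pi> x = (if x < s then \<pi>' x else if Suc x = s + a then s
     else if x < s + a then Suc x else x)" for x
  have \<pi>'_lt: "\<pi>' x < s \<longleftrightarrow> x < s" for x using permutes_in_image[OF \<pi>'(1), of x] by simp
  have inj: "inj_on \<pi> {..<s + a}"
  proof (rule inj_onI)
    fix x y assume "x \<in> {..<s + a}" "y \<in> {..<s + a}" "\<pi> x = \<pi> y"
    then show "x = y"
      using \<pi>'_lt[of x] \<pi>'_lt[of y] injD[OF permutes_inj[OF \<pi>'(1)], of x y]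
      by (auto simp: \<pi>_def split: if_splits)
  qed
  have "\<pi> ` {..<s + a} \<subseteq> {..<s + a}"
  proof
    fix y assume "y \<in> \<pi> ` {..<s + a}"
    then obtain x where "x < s + a" "y = \<pi> x" by auto
    then show "y \<in> {..<s + a}" using a \<pi>'_lt[of x] by (auto simp: \<pi>_def split: if_splits)
  qed
  then have "bij_betw \<pi> {..<s + a} {..<s + a}" using inj by (simp add: bij_betw_def endo_inj_surj)
  then have \<pi>: "\<pi> permutes {..<s + a}"
    using \<pi>'_lt a by (intro bij_imp_permutes) (auto simp: \<pi>_def)
  then have p\<pi>: "permutation \<pi>" by (rule permutes_finite_permutation)
  have old: "orbit \<pi> x = orbit \<pi>' x" if "x < s" for x
    using that \<pi>'_lt by (intro orbit_cong0[of x "{..<s}"]) (auto simp: \<pi>_def)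
  have pow: "(\<pi> ^^ i) s = s + i" if "i < a" for i
    using that by (induction i) (auto simp: \<pi>_def)
  have new_s: "orbit \<pi> s = {s..<s + a}"
  proof
    show "orbit \<pi> s \<subseteq> {s..<s + a}"
    proof
      fix y assume "y \<in> orbit \<pi> s"
      then show "y \<in> {s..<s + a}" by induction (use a in \<open>auto simp: \<pi>_def\<close>)
    qed
  next
    show "{s..<s + a} \<subseteq> orbit \<pi> s"
    proof
      fix y assume "y \<in> {s..<s + a}"
      then have "y = (\<pi> ^^ (y - s)) s" using pow[of "y - s"] by auto
      also have "\<dots> \<in> orbit \<pi> s"
        by (intro funpow_in_orbit permutation_self_in_orbit p\<pi>)
      finally show "y \<in> orbit \<pi> s" .
    qed
  qed
  have new: "orbit \<pi> x = {s..<s + a}" if "x \<in> {s..<s + a}" for x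
    using cyclic_on_orbit'[OF p\<pi>, of s] that new_s by (metis orbit_cyclic_eq3)
  have "{..<s + a} = {..<s} \<union> {s..<s + a}" by auto
  then have "orbit \<pi> ` {..<s + a} = orbit \<pi> ` {..<s} \<union> orbit \<pi> ` {s..<s + a}"
    by (simp only: image_Un)
  also have "orbit \<pi> ` {..<s} = orbit \<pi>' ` {..<s}" using old by auto
  also have "orbit \<pi> ` {s..<s + a} = (\<lambda>x. {s..<s + a}) ` {s..<s + a}" using new by auto
  also have "\<dots> = {{s..<s + a}}" using a by (intro image_constant[of s]) auto
  finally have orbits: "orbit \<pi> ` {..<s + a} = insert {s..<s + a} (orbit \<pi>' ` {..<s})" by simp
  have "{s..<s + a} \<notin> orbit \<pi>' ` {..<s}"
    using permutes_orbit_subset[OF \<pi>'(1)] a by fastforce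
  then have "cycle_type (s + a) \<pi> = add_mset a (mset \<alpha>)"
    using \<pi>'(2) by (simp add: cycle_type_def orbits)
  then have "\<pi> \<in> conj_class (a # \<alpha>)"
    using \<pi> by (simp add: conj_class_def s_def add.commute)
  then show ?case by blast
qed

lemma finite_conj_class: "finite (conj_class \<alpha>)"
  by (rule finite_subset[OF _ finite_permutations[of "{..<sum_list \<alpha>}"]])
     (auto simp: conj_class_def)

lemma id_in_conj_class: "id \<in> conj_class (replicate n 1)"
proof -
  have "orbit id x = {x}" for x :: nat by (simp add: orbit_eq_singleton_iff)
  then have "orbit id ` {..<n} = (\<lambda>x. {x}) ` {..<n}" by auto
  then have "cycle_type n id = image_mset card (image_mset (\<lambda>x. {x}) (mset_set {..<n}))"
    by (simp add: cycle_type_def image_mset_mset_set)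
  also have "\<dots> = replicate_mset n 1" by (simp add: image_mset.compositionality o_def image_mset_const_eq)
  finally show ?thesis by (simp add: conj_class_def permutes_id sum_list_replicate)
qed

lemma Partitions_mset_eq:
  assumes "\<alpha> \<in> Partitions" "\<beta> \<in> Partitions" "mset \<alpha> = mset \<beta>"
  shows "\<alpha> = \<beta>"
proof -
  have "sorted (rev \<alpha>)" "sorted (rev \<beta>)"
    using assms(1,2) by (auto simp: Partitions_def sorted_wrt_rev)
  then have "rev \<alpha> = rev \<beta>"
    using assms(3) by (metis mset_rev properties_for_sort)
  then show ?thesis by simp
qed

lemma Partition_of_mset:
  assumes "0 \<notin># M"
  obtains \<alpha> where "\<alpha> \<in> Partitions" "mset \<alpha> = M"
proof
  show "rev (sorted_list_of_multiset M) \<in> Partitions"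
    using assms by (simp add: Partitions_def sorted_wrt_rev)
qed simp

text \<open>The orbits partition \<open>{..<n}\<close>, so their sizes add up to \<open>n\<close>.\<close>

lemma permutes_cycle_type:
  assumes \<pi>: "\<pi> permutes {..<n}"
  obtains \<alpha> where "\<alpha> \<in> partitions_of n" "\<pi> \<in> conj_class \<alpha>"
proof -
  have p\<pi>: "permutation \<pi>" using \<pi> by (rule permutes_finite_permutation)
  have fin: "finite (orbit \<pi> x)" for x
    by (intro finite_orbit permutation_self_in_orbit p\<pi>)
  have "0 \<notin># cycle_type n \<pi>"
    using orbit_nonempty[of \<pi>] fin by (simp add: cycle_type_def image_iff)
  then obtain \<alpha> where \<alpha>: "\<alpha> \<in> Partitions" "mset \<alpha> = cycle_type n \<pi>"
    by (rule Partition_of_mset)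
  have "\<Union> (orbit \<pi> ` {..<n}) = {..<n}"
    using permutes_orbit_subset[OF \<pi>] permutation_self_in_orbit[OF p\<pi>] by blast
  moreover have "card (\<Union> (orbit \<pi> ` {..<n})) = (\<Sum>A\<in>orbit \<pi> ` {..<n}. card A)"
  proof (rule card_Union_disjoint)
    have same: "orbit \<pi> x = orbit \<pi> y" if "z \<in> orbit \<pi> x" "z \<in> orbit \<pi> y" for x y z
      using that cyclic_on_orbit'[OF p\<pi>] by (metis orbit_cyclic_eq3)
    then show "pairwise disjnt (orbit \<pi> ` {..<n})" 
      unfolding pairwise_def disjnt_iff using same by blast
  qed (use fin in auto)
  ultimately have "sum_mset (cycle_type n \<pi>) = n"
    by (simp add: cycle_type_def sum_unfold_sum_mset)
  then have "sum_list \<alpha> = n" using \<alpha>(2) by (metis sum_mset_sum_list)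
  with \<alpha> \<pi> show ?thesis
    by (intro that[of \<alpha>]) (auto simp: partitions_of_def conj_class_def)
qed

section \<open>Diagrams and the dominance order\<close>

lemma diagram_Sigma: "diagram \<nu> = Sigma {..<length \<nu>} (\<lambda>i. {..<\<nu> ! i})"
  by (auto simp: diagram_def)

lemma finite_diagram [simp]: "finite (diagram \<nu>)"
  by (simp add: diagram_Sigma)

lemma card_diagram: "card (diagram \<nu>) = sum_list \<nu>"
  by (simp add: diagram_Sigma sum_list_sum_nth atLeast0LessThan)

lemma diagram_up_closed:
  assumes "\<nu> \<in> Partitions" "(i, j) \<in> diagram \<nu>" "i' \<le> i"
  shows "(i', j) \<in> diagram \<nu>"
proof -
  have "\<nu> ! i \<le> \<nu> ! i'"
    using assms by (cases "i' = i") (auto simp: Partitions_def diagram_def sorted_wrt_iff_nth_less)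
  with assms show ?thesis by (auto simp: diagram_def)
qed

lemma down_closed_eq_lessThan:
  fixes A :: "nat set"
  assumes "finite A" "\<And>i j. i \<in> A \<Longrightarrow> j \<le> i \<Longrightarrow> j \<in> A"
  shows "A = {..<card A}"
proof (cases "A = {}")
  case False
  then have "Max A \<in> A" using assms(1) by (rule Max_in[rotated])
  then have "A = {..Max A}" using assms(2)[OF \<open>Max A \<in> A\<close>] Max_ge[OF assms(1)] by blast
  then show ?thesis by (metis card_atMost lessThan_Suc_atMost)
qed auto

definition column :: "nat list \<Rightarrow> nat \<Rightarrow> (nat \<times> nat) set" where
  "column \<nu> j = {b \<in> diagram \<nu>. snd b = j}"

lemma finite_column [simp]: "finite (column \<nu> j)"
  by (simp add: column_def)

lemma column_eq:
  assumes "\<nu> \<in> Partitions"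
  shows "column \<nu> j = (\<lambda>r. (r, j)) ` {..<card (column \<nu> j)}"
proof -
  let ?A = "fst ` column \<nu> j"
  have inj: "inj_on fst (column \<nu> j)" by (auto simp: inj_on_def column_def)
  have col: "column \<nu> j = (\<lambda>r. (r, j)) ` ?A" by (force simp: column_def)
  have "?A = {..<card ?A}"
  proof (rule down_closed_eq_lessThan)
    fix i i' assume "i \<in> ?A" "i' \<le> i"
    then have "(i', j) \<in> column \<nu> j"
      using diagram_up_closed[OF assms] by (auto simp: column_def)
    then show "i' \<in> ?A" by force
  qed simp
  then have "?A = {..<card (column \<nu> j)}" by (simp add: card_image[OF inj])
  then show ?thesis using col by simp
qed

text \<open>The partial sums that define dominance: \<open>\<kappa>\<close> dominates \<open>\<mu>\<close> when \<open>head_size \<mu> i \<le> head_size \<kappa> i\<close>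
for all \<open>i\<close>. Counting cells instead of adding parts avoids a case distinction beyond the last row.\<close>

definition head_size :: "nat list \<Rightarrow> nat \<Rightarrow> nat" where
  "head_size \<nu> i = card {b \<in> diagram \<nu>. fst b < i}"

lemma column_low_rows:
  assumes "\<nu> \<in> Partitions"
  shows "card {b \<in> column \<nu> j. fst b < i} = min i (card (column \<nu> j))"
proof -
  have "{b \<in> column \<nu> j. fst b < i} = (\<lambda>r. (r, j)) ` {..<min i (card (column \<nu> j))}"
    by (subst column_eq[OF assms]) auto
  then show ?thesis by (simp add: card_image inj_on_def)
qed

text \<open>At most \<open>i\<close> cells of a column can be given distinct row numbers below \<open>i\<close>, and the actual row
numbers achieve the maximum.\<close>

lemma column_low_le:
  assumes "\<nu> \<in> Partitions" "inj_on r (column \<nu> j)"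
  shows "card {b \<in> column \<nu> j. r b < i} \<le> card {b \<in> column \<nu> j. fst b < i}"
proof -
  have "card {b \<in> column \<nu> j. r b < i} = card (r ` {b \<in> column \<nu> j. r b < i})"
    using assms(2) by (intro card_image[symmetric]) (auto simp: inj_on_def)
  also have "\<dots> \<le> card {..<i}" by (intro card_mono) auto
  finally have "card {b \<in> column \<nu> j. r b < i} \<le> i" by simp
  moreover have "card {b \<in> column \<nu> j. r b < i} \<le> card (column \<nu> j)" by (intro card_mono) auto
  ultimately show ?thesis by (simp add: column_low_rows[OF assms(1)])
qed

lemma card_by_columns:
  "card {b \<in> diagram \<nu>. P b} = (\<Sum>j\<in>snd ` diagram \<nu>. card {b \<in> column \<nu> j. P b})"
proof -
  have "(\<Sum>j\<in>snd ` diagram \<nu>. \<Sum>b | b \<in> {b \<in> diagram \<nu>. P b} \<and> snd b = j. 1::nat)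
      = (\<Sum>b\<in>{b \<in> diagram \<nu>. P b}. 1)"
    by (rule sum.group) auto
  moreover have "{b. b \<in> {b \<in> diagram \<nu>. P b} \<and> snd b = j} = {b \<in> column \<nu> j. P b}" for j
    by (auto simp: column_def)
  ultimately show ?thesis by (simp only: card_eq_sum)
qed

text \<open>The combinatorial source of dominance. The function \<open>r\<close> assigns new rows to the cells of \<open>\<nu>\<close>; later it is
the row of a tabloid of another shape in which an entry of a tableau lies.\<close>

lemma column_injective_head_le:
  assumes "\<nu> \<in> Partitions" "\<And>j. inj_on r (column \<nu> j)"
  shows "card {b \<in> diagram \<nu>. r b < i} \<le> head_size \<nu> i"
  unfolding head_size_def card_by_columns
  using assms by (intro sum_mono column_low_le)

text \<open>If the inequality of dominance is an equality for every \<open>i\<close>, it is one in each column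
separately; taking \<open>i\<close> to be the height of the column, the new rows of its cells are exactly the
rows of that column.\<close>

lemma column_injective_head_eq:
  assumes \<nu>: "\<nu> \<in> Partitions" and inj: "\<And>j. inj_on r (column \<nu> j)"
    and eq: "\<And>i. card {b \<in> diagram \<nu>. r b < i} = head_size \<nu> i"
    and b: "b \<in> diagram \<nu>"
  shows "(r b, snd b) \<in> diagram \<nu>"
proof -
  let ?j = "snd b"
  \<comment> \<open>the height of the column\<close>
  let ?i = "card (column \<nu> ?j)"
  have "card {b \<in> column \<nu> ?j. r b < ?i} = card {b \<in> column \<nu> ?j. fst b < ?i}"
    using eq[of ?i] unfolding head_size_def card_by_columns
    by (rule sum_mono_inv) (use b in \<open>auto intro: column_low_le[OF \<nu> inj]\<close>)
  also have "\<dots> = card (column \<nu> ?j)" by (simp add: column_low_rows[OF \<nu>])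
  finally have "{b \<in> column \<nu> ?j. r b < ?i} = column \<nu> ?j"
    by (intro card_subset_eq) auto
  moreover have "b \<in> column \<nu> ?j" using b by (simp add: column_def)
  ultimately have "r b < ?i" by blast
  then have "(r b, ?j) \<in> column \<nu> ?j" by (subst column_eq[OF \<nu>]) simp
  then show ?thesis by (simp add: column_def)
qed

lemma head_size_Suc:
  "head_size \<nu> (Suc i) = head_size \<nu> i + (if i < length \<nu> then \<nu> ! i else 0)"
proof -
  have "{b \<in> diagram \<nu>. fst b < Suc i} = {b \<in> diagram \<nu>. fst b < i} \<union>
      (if i < length \<nu> then {i} \<times> {..<\<nu> ! i} else {})"
    by (auto simp: diagram_def less_Suc_eq)
  moreover have "{b \<in> diagram \<nu>. fst b < i} \<inter> (if i < length \<nu> then {i} \<times> {..<\<nu> ! i} else {}) = {}"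
    by auto
  ultimately show ?thesis by (simp add: head_size_def card_Un_disjoint)
qed

lemma length_partition_le:
  assumes "\<nu> \<in> partitions_of n"
  shows "length \<nu> \<le> n"
proof -
  have "(\<Sum>x\<leftarrow>\<nu>. 1) \<le> (\<Sum>x\<leftarrow>\<nu>. x)"
  proof (rule sum_list_mono)
    fix x assume "x \<in> set \<nu>"
    then have "x \<noteq> 0"
      using assms unfolding partitions_of_def Partitions_def by (metis (no_types, lifting) mem_Collect_eq)
    then show "1 \<le> x" by simp
  qed
  then show ?thesis using assms by (simp add: partitions_of_def sum_list_triv)
qed

lemma finite_partitions_of [simp]: "finite (partitions_of n)"
proof (rule finite_subset)
  show "partitions_of n \<subseteq> {xs. set xs \<subseteq> {..n} \<and> length xs \<le> n}"
    using length_partition_le by (auto simp: partitions_of_def member_le_sum_list)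
  show "finite {xs. set xs \<subseteq> {..n} \<and> length xs \<le> n}" by (rule finite_lists_length_le) simp
qed

lemma partition_eq_if_head_size_eq:
  assumes "\<mu> \<in> partitions_of n" "\<nu> \<in> partitions_of n" "\<And>i. i \<le> n \<Longrightarrow> head_size \<mu> i = head_size \<nu> i"
  shows "\<mu> = \<nu>"
proof -
  have row: "(if i < length \<mu> then \<mu> ! i else 0) = (if i < length \<nu> then \<nu> ! i else 0)" if "i < n" for i
    using head_size_Suc[of \<mu> i] head_size_Suc[of \<nu> i] assms(3)[of i] assms(3)[of "Suc i"] that
    by linarith
  have len: "length \<beta> \<le> length \<alpha>" if "\<alpha> \<in> partitions_of n" "\<beta> \<in> partitions_of n"
    "\<And>i. i < n \<Longrightarrow> (if i < length \<alpha> then \<alpha> ! i else 0) = (if i < length \<beta> then \<beta> ! i else 0)" for \<alpha> \<beta>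
  proof (rule ccontr)
    assume "\<not> ?thesis"
    then have "length \<alpha> < length \<beta>" by simp
    moreover then have "\<beta> ! length \<alpha> \<in> set \<beta>" by (rule nth_mem)
    then have "\<beta> ! length \<alpha> \<noteq> 0"
      using that(2) unfolding partitions_of_def Partitions_def by (metis (no_types, lifting) mem_Collect_eq)
    ultimately show False using that(3)[of "length \<alpha>"] length_partition_le[OF that(2)] by simp
  qed
  have "length \<mu> = length \<nu>"
    using len[OF assms(1,2) row] len[OF assms(2,1) row[symmetric]] by simp
  then show ?thesis
    using row length_partition_le[OF assms(1)] by (intro nth_equalityI) (metis order.strict_trans2)+
qed


section \<open>Tabloids and the permutation modules\<close>

lemma perm_tabloid_comp: "perm_tabloid (\<sigma> \<circ> \<tau>) T = perm_tabloid \<sigma> (perm_tabloid \<tau> T)"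
  by (simp add: perm_tabloid_def image_comp)

lemma perm_tabloid_id [simp]: "perm_tabloid id T = T"
  by (simp add: perm_tabloid_def)

lemma tabloid_of_comp: "tabloid_of \<nu> (\<pi> \<circ> t) = perm_tabloid \<pi> (tabloid_of \<nu> t)"
  by (simp add: tabloid_of_def perm_tabloid_def image_comp)

text \<open>Summing over a common finite superset of the supports is what allows vectors with different
supports to be added.\<close>

lemma perm_action_superset:
  assumes "finite S" "Poly_Mapping.keys v \<subseteq> S"
  shows "perm_action \<pi> v = (\<Sum>T\<in>S. Poly_Mapping.single (perm_tabloid \<pi> T) (Poly_Mapping.lookup v T))"
  unfolding perm_action_def
  by (rule sum.mono_neutral_left) (use assms in \<open>auto simp: in_keys_iff\<close>)

lemma perm_action_linear: "pm_linear (perm_action \<pi>)"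
proof (rule pm_linearI)
  fix v w :: "tabloid \<Rightarrow>\<^sub>0 'a"
  let ?S = "Poly_Mapping.keys v \<union> Poly_Mapping.keys w"
  have "perm_action \<pi> (v + w) = (\<Sum>T\<in>?S. Poly_Mapping.single (perm_tabloid \<pi> T) (Poly_Mapping.lookup (v + w) T))"
    by (rule perm_action_superset) (use keys_add[of v w] in auto)
  also have "\<dots> = perm_action \<pi> v + perm_action \<pi> w"
    by (simp add: lookup_add single_add sum.distrib perm_action_superset[of ?S v] perm_action_superset[of ?S w])
  finally show "perm_action \<pi> (v + w) = perm_action \<pi> v + perm_action \<pi> w" .
next
  fix c :: 'a and v :: "tabloid \<Rightarrow>\<^sub>0 'a"
  have "perm_action \<pi> (pm_scale c v) = (\<Sum>T\<in>Poly_Mapping.keys v.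
      Poly_Mapping.single (perm_tabloid \<pi> T) (Poly_Mapping.lookup (pm_scale c v) T))"
    by (rule perm_action_superset) (auto simp: in_keys_iff)
  also have "\<dots> = pm_scale c (perm_action \<pi> v)"
    by (simp add: perm_action_def pm.scale_sum_right)
  finally show "perm_action \<pi> (pm_scale c v) = pm_scale c (perm_action \<pi> v)" .
qed

lemma perm_action_single [simp]:
  "perm_action \<pi> (Poly_Mapping.single T c) = Poly_Mapping.single (perm_tabloid \<pi> T) c"
  by (subst perm_action_superset[of "{T}"]) (auto simp: in_keys_iff lookup_single when_def)

lemma perm_action_comp: "perm_action (\<sigma> \<circ> \<tau>) v = perm_action \<sigma> (perm_action \<tau> v)"
proof -
  have "perm_action \<sigma> (perm_action \<tau> v) = (\<Sum>T\<in>Poly_Mapping.keys v.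
     perm_action \<sigma> (Poly_Mapping.single (perm_tabloid \<tau> T) (Poly_Mapping.lookup v T)))"
    unfolding perm_action_def[of \<tau>] by (rule pmp.linear_sum[OF perm_action_linear])
  then show ?thesis by (simp add: perm_action_def[of "\<sigma> \<circ> \<tau>"] perm_tabloid_comp)
qed

lemma perm_action_id [simp]: "perm_action id v = v"
  by (simp add: perm_action_def poly_mapping_sum_singles)

text \<open>The module usually written \<open>M\<^sup>\<nu>\<close>, with the tabloids of shape \<open>\<nu>\<close> as basis.\<close>

definition perm_module :: "nat list \<Rightarrow> (tabloid \<Rightarrow>\<^sub>0 'a::field) set" where
  "perm_module \<nu> = pm.span ((\<lambda>t. Poly_Mapping.single (tabloid_of \<nu> t) 1) ` tableaux \<nu>)"

lemma comp_in_tableaux: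
  assumes "t \<in> tableaux \<nu>" "\<pi> permutes {..<sum_list \<nu>}"
  shows "\<pi> \<circ> t \<in> tableaux \<nu>"
  using assms bij_betw_trans permutes_imp_bij by (fastforce simp: tableaux_def)

lemma tableaux_nonempty: "tableaux \<nu> \<noteq> {}"
proof -
  have "\<exists>t. bij_betw t (diagram \<nu>) {..<sum_list \<nu>}"
    by (rule finite_same_card_bij) (auto simp: card_diagram)
  then show ?thesis by (auto simp: tableaux_def)
qed

text \<open>There are infinitely many tableaux, since their values off the diagram are arbitrary, but these
values do not affect the tabloid.\<close>

lemma finite_tabloids: "finite (tabloid_of \<nu> ` tableaux \<nu>)"
proof (rule finite_subset)
  show "tabloid_of \<nu> ` tableaux \<nu> \<subseteq>
      {T. \<forall>i. (i \<in> {..<length \<nu>} \<longrightarrow> T i \<in> Pow {..<sum_list \<nu>}) \<and> (i \<notin> {..<length \<nu>} \<longrightarrow> T i = {})}"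
    by (auto simp: tabloid_of_def tableaux_def bij_betw_def diagram_def)
  show "finite {T. \<forall>i. (i \<in> {..<length \<nu>} \<longrightarrow> T i \<in> Pow {..<sum_list \<nu>}) \<and> (i \<notin> {..<length \<nu>} \<longrightarrow> T i = ({}::nat set))}"
    by (rule finite_set_of_finite_funs) auto
qed

section \<open>Column antisymmetrizers\<close>

text \<open>The action of the signed column sum \<open>\<Sum> sgn(\<sigma>) \<sigma>\<close> of a tableau \<open>t\<close> of shape \<open>\<nu>\<close>. It is applied to tabloids of
any shape of the same size, not only to those of shape \<open>\<nu>\<close>.\<close>

definition antisymmetrizer ::
  "nat list \<Rightarrow> (nat \<times> nat \<Rightarrow> nat) \<Rightarrow> (tabloid \<Rightarrow>\<^sub>0 'a::field) \<Rightarrow> (tabloid \<Rightarrow>\<^sub>0 'a)" where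
  "antisymmetrizer \<nu> t v =
     (\<Sum>\<sigma>\<in>column_stabilizer \<nu> t. pm_scale (of_int (sign \<sigma>)) (perm_action \<sigma> v))"

lemma column_stabilizer_iff:
  "\<sigma> \<in> column_stabilizer \<nu> t \<longleftrightarrow>
     \<sigma> permutes {..<sum_list \<nu>} \<and> (\<forall>j. \<sigma> ` t ` column \<nu> j = t ` column \<nu> j)"
  by (simp add: column_stabilizer_def column_def)

lemma finite_column_stabilizer [simp]: "finite (column_stabilizer \<nu> t)"
  by (rule finite_subset[OF _ finite_permutations[of "{..<sum_list \<nu>}"]])
     (auto simp: column_stabilizer_iff)

lemma column_stabilizer_permutes: "\<sigma> \<in> column_stabilizer \<nu> t \<Longrightarrow> \<sigma> permutes {..<sum_list \<nu>}"
  by (simp add: column_stabilizer_iff)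

lemma column_stabilizer_permutation: "\<sigma> \<in> column_stabilizer \<nu> t \<Longrightarrow> permutation \<sigma>"
  using column_stabilizer_permutes permutes_finite_permutation by blast

lemma id_in_column_stabilizer [simp]: "id \<in> column_stabilizer \<nu> t"
  by (simp add: column_stabilizer_iff permutes_id)

lemma column_stabilizer_comp:
  assumes "\<sigma> \<in> column_stabilizer \<nu> t" "\<tau> \<in> column_stabilizer \<nu> t"
  shows "\<sigma> \<circ> \<tau> \<in> column_stabilizer \<nu> t"
  using assms unfolding column_stabilizer_iff
  by (simp only: permutes_compose image_comp[symmetric]) simp

lemma column_stabilizer_inv:
  assumes \<sigma>: "\<sigma> \<in> column_stabilizer \<nu> t"
  shows "inv \<sigma> \<in> column_stabilizer \<nu> t"
proof -
  have "inv \<sigma> ` t ` column \<nu> j = t ` column \<nu> j" for j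
  proof -
    have "inv \<sigma> ` t ` column \<nu> j = inv \<sigma> ` \<sigma> ` t ` column \<nu> j"
      using \<sigma> by (simp add: column_stabilizer_iff)
    also have "\<dots> = t ` column \<nu> j"
      using permutes_inj[OF column_stabilizer_permutes[OF \<sigma>]] by (simp add: image_inv_f_f)
    finally show ?thesis .
  qed
  then show ?thesis
    using permutes_inv[OF column_stabilizer_permutes[OF \<sigma>]] by (simp add: column_stabilizer_iff)
qed

lemma antisymmetrizer_linear: "pm_linear (antisymmetrizer \<nu> t)"
  by (rule pm_linearI)
     (simp_all add: antisymmetrizer_def pmp.linear_add[OF perm_action_linear]
       pmp.linear_scale[OF perm_action_linear] pm.scale_right_distrib sum.distrib
       pm.scale_sum_right mult.commute)

text \<open>Right multiplication by \<open>\<tau>\<close> permutes the column stabilizer and changes all signs by that of \<open>\<tau>\<close>.\<close>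

lemma antisymmetrizer_perm_action:
  fixes v :: "tabloid \<Rightarrow>\<^sub>0 'a::field"
  assumes \<tau>: "\<tau> \<in> column_stabilizer \<nu> t"
  shows "antisymmetrizer \<nu> t (perm_action \<tau> v) = pm_scale (of_int (sign \<tau>)) (antisymmetrizer \<nu> t v)"
proof -
  let ?K = "column_stabilizer \<nu> t"
  have inv: "\<tau> \<circ> inv \<tau> = id" "inv \<tau> \<circ> \<tau> = id"
    using permutes_inv_o[OF column_stabilizer_permutes[OF \<tau>]] by auto
  have s: "of_int (sign \<sigma>) = of_int (sign \<tau>) * (of_int (sign (\<sigma> \<circ> \<tau>)) :: 'a)" if "\<sigma> \<in> ?K" for \<sigma>
  proof -
    have "sign (\<sigma> \<circ> \<tau>) = sign \<sigma> * sign \<tau>"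
      using that \<tau> by (intro sign_compose column_stabilizer_permutation)
    then show ?thesis by (cases "sign \<tau> = 1") (auto simp: sign_def split: if_splits)
  qed
  have "antisymmetrizer \<nu> t (perm_action \<tau> v) = (\<Sum>\<sigma>\<in>?K. pm_scale (of_int (sign \<tau>))
       (pm_scale (of_int (sign (\<sigma> \<circ> \<tau>))) (perm_action (\<sigma> \<circ> \<tau>) v)))"
    unfolding antisymmetrizer_def
    by (rule sum.cong [OF refl]) (simp only: perm_action_comp s pm.scale_scale)
  also have "\<dots> = (\<Sum>\<sigma>\<in>?K. pm_scale (of_int (sign \<tau>)) (pm_scale (of_int (sign \<sigma>)) (perm_action \<sigma> v)))"
    by (rule sum.reindex_bij_witness[of _ "\<lambda>\<rho>. \<rho> \<circ> inv \<tau>" "\<lambda>\<sigma>. \<sigma> \<circ> \<tau>"])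
       (auto simp: o_assoc[symmetric] inv intro: column_stabilizer_comp column_stabilizer_inv \<tau>)
  finally show ?thesis by (simp add: antisymmetrizer_def pm.scale_sum_right)
qed

lemma polytabloid_eq:
  "polytabloid \<nu> t = antisymmetrizer \<nu> t (Poly_Mapping.single (tabloid_of \<nu> t) 1)"
  by (simp add: polytabloid_def antisymmetrizer_def)

text \<open>The transposition of the two entries lies in the column stabilizer and fixes the tabloid, so the result
equals its own negative.\<close>

lemma antisymmetrizer_eq_0:
  assumes t: "t \<in> tableaux \<kappa>" and s: "s \<in> tableaux \<mu>" and n: "sum_list \<mu> = sum_list \<kappa>"
    and b: "b \<in> column \<kappa> j" "b' \<in> column \<kappa> j" "b \<noteq> b'"
    and c: "c \<in> diagram \<mu>" "c' \<in> diagram \<mu>" "s c = t b" "s c' = t b'" "fst c = fst c'"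
  shows "antisymmetrizer \<kappa> t (Poly_Mapping.single (tabloid_of \<mu> s) (x :: 'a::field_char_0)) = 0"
proof -
  have inj_t: "inj_on t (diagram \<kappa>)" and inj_s: "inj_on s (diagram \<mu>)"
    using t s by (auto simp: tableaux_def bij_betw_def)
  have bD: "b \<in> diagram \<kappa>" "b' \<in> diagram \<kappa>" using b by (auto simp: column_def)
  have ne: "t b \<noteq> t b'" using inj_onD[OF inj_t] b bD by blast
  let ?\<tau> = "transpose (t b) (t b')"
  have "t b \<in> {..<sum_list \<kappa>}" "t b' \<in> {..<sum_list \<kappa>}"
    using t bD by (auto simp: tableaux_def bij_betw_def)
  then have perm: "?\<tau> permutes {..<sum_list \<kappa>}" by (rule permutes_swap_id)
  have "t b \<in> t ` column \<kappa> k \<longleftrightarrow> t b' \<in> t ` column \<kappa> k" for k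
  proof -
    have "column \<kappa> k \<subseteq> diagram \<kappa>" by (auto simp: column_def)
    then show ?thesis
      using b bD by (simp add: inj_on_image_mem_iff[OF inj_t] column_def)
  qed
  then have "?\<tau> ` t ` column \<kappa> k = t ` column \<kappa> k" for k by (rule transpose_image_eq)
  then have \<tau>: "?\<tau> \<in> column_stabilizer \<kappa> t"
    using perm by (simp add: column_stabilizer_iff)
  have "t b \<in> tabloid_of \<mu> s i \<longleftrightarrow> t b' \<in> tabloid_of \<mu> s i" for i
  proof -
    have "{x \<in> diagram \<mu>. fst x = i} \<subseteq> diagram \<mu>" by auto
    then show ?thesis
      using c(1,2,5) unfolding c(3,4)[symmetric] tabloid_of_def
      by (simp add: inj_on_image_mem_iff[OF inj_s])
  qed
  then have "perm_tabloid ?\<tau> (tabloid_of \<mu> s) = tabloid_of \<mu> s"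
    unfolding perm_tabloid_def by (intro ext transpose_image_eq)
  then have "antisymmetrizer \<kappa> t (Poly_Mapping.single (tabloid_of \<mu> s) x) =
      antisymmetrizer \<kappa> t (perm_action ?\<tau> (Poly_Mapping.single (tabloid_of \<mu> s) x))"
    by simp
  also have "\<dots> = - antisymmetrizer \<kappa> t (Poly_Mapping.single (tabloid_of \<mu> s) x)"
    by (simp only: antisymmetrizer_perm_action[OF \<tau>]) (simp add: sign_swap_id ne)
  finally have eq: "antisymmetrizer \<kappa> t (Poly_Mapping.single (tabloid_of \<mu> s) x) =
      - antisymmetrizer \<kappa> t (Poly_Mapping.single (tabloid_of \<mu> s) x)" .
  show ?thesis
  proof (rule poly_mapping_eqI)
    fix T
    show "Poly_Mapping.lookup (antisymmetrizer \<kappa> t (Poly_Mapping.single (tabloid_of \<mu> s) x)) T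
       = Poly_Mapping.lookup 0 T"
      using arg_cong[OF eq, of "\<lambda>v. Poly_Mapping.lookup v T"] by (simp add: eq_neg_iff_add_eq_0 flip: mult_2)
  qed
qed

definition row_in :: "nat list \<Rightarrow> (nat \<times> nat \<Rightarrow> nat) \<Rightarrow> nat \<Rightarrow> nat" where
  "row_in \<mu> s x = fst (inv_into (diagram \<mu>) s x)"

lemma card_row_in:
  assumes t: "t \<in> tableaux \<kappa>" and s: "s \<in> tableaux \<mu>" and n: "sum_list \<mu> = sum_list \<kappa>"
  shows "card {b \<in> diagram \<kappa>. row_in \<mu> s (t b) < i} = head_size \<mu> i"
proof -
  let ?g = "inv_into (diagram \<mu>) s \<circ> t"
  have g: "bij_betw ?g (diagram \<kappa>) (diagram \<mu>)"
    using t s n by (auto simp: tableaux_def intro!: bij_betw_trans bij_betw_inv_into)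
  have "?g ` {b \<in> diagram \<kappa>. fst (?g b) < i} = {c \<in> ?g ` diagram \<kappa>. fst c < i}"
    by blast
  then have im: "?g ` {b \<in> diagram \<kappa>. fst (?g b) < i} = {c \<in> diagram \<mu>. fst c < i}"
    by (simp only: bij_betw_imp_surj_on[OF g])
  have "inj_on ?g {b \<in> diagram \<kappa>. fst (?g b) < i}"
    using bij_betw_imp_inj_on[OF g] by (rule inj_on_subset) auto
  from card_image[OF this] show ?thesis
    unfolding im by (simp add: head_size_def row_in_def)
qed

lemma antisymmetrizer_eq_0_if_not_inj:
  assumes t: "t \<in> tableaux \<kappa>" and s: "s \<in> tableaux \<mu>" and n: "sum_list \<mu> = sum_list \<kappa>"
    and ni: "\<not> inj_on (\<lambda>b. row_in \<mu> s (t b)) (column \<kappa> j)"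
  shows "antisymmetrizer \<kappa> t (Poly_Mapping.single (tabloid_of \<mu> s) (x :: 'a::field_char_0)) = 0"
proof -
  obtain b b' where b: "b \<in> column \<kappa> j" "b' \<in> column \<kappa> j" "b \<noteq> b'"
    and r: "row_in \<mu> s (t b) = row_in \<mu> s (t b')"
    using ni by (auto simp: inj_on_def)
  have "t b \<in> s ` diagram \<mu>" "t b' \<in> s ` diagram \<mu>"
    using b t s n by (auto simp: tableaux_def bij_betw_def column_def)
  then show ?thesis
    by (intro antisymmetrizer_eq_0[OF t s n b, where
          c = "inv_into (diagram \<mu>) s (t b)" and c' = "inv_into (diagram \<mu>) s (t b')"])
       (use r in \<open>auto simp: row_in_def inv_into_into f_inv_into_f\<close>)
qed

text \<open>If dominance fails, no tabloid of shape \<open>\<mu>\<close> can separate the entries of every column of \<open>t\<close>, so all of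
them are killed.\<close>

lemma antisymmetrizer_perm_module_eq_0:
  assumes \<kappa>: "\<kappa> \<in> Partitions" and t: "t \<in> tableaux \<kappa>" and n: "sum_list \<mu> = sum_list \<kappa>"
    and nd: "\<not> head_size \<mu> i \<le> head_size \<kappa> i" and v: "v \<in> perm_module \<mu>"
  shows "antisymmetrizer \<kappa> t (v :: tabloid \<Rightarrow>\<^sub>0 'a::field_char_0) = 0"
  using _ v unfolding perm_module_def
proof (rule pmp.linear_eq_0_on_span[OF antisymmetrizer_linear])
  fix v :: "tabloid \<Rightarrow>\<^sub>0 'a"
  assume "v \<in> (\<lambda>s. Poly_Mapping.single (tabloid_of \<mu> s) 1) ` tableaux \<mu>"
  then obtain s where s: "s \<in> tableaux \<mu>" "v = Poly_Mapping.single (tabloid_of \<mu> s) 1" by auto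
  obtain j where "\<not> inj_on (\<lambda>b. row_in \<mu> s (t b)) (column \<kappa> j)"
    using column_injective_head_le[OF \<kappa>, of "\<lambda>b. row_in \<mu> s (t b)" i] nd
    unfolding card_row_in[OF t s(1) n] by auto
  then show "antisymmetrizer \<kappa> t v = 0"
    unfolding s(2) by (rule antisymmetrizer_eq_0_if_not_inj[OF t s(1) n])
qed

text \<open>A tabloid of the same shape that separates the entries of every column places them in the
rows which that column occupies. Hence moving each entry within its column of \<open>t\<close> to the row prescribed by
\<open>s\<close> is a bijection of the diagram, and it comes from a column permutation.\<close>

lemma tabloid_column_equivalent:
  assumes \<kappa>: "\<kappa> \<in> Partitions" and t: "t \<in> tableaux \<kappa>" and s: "s \<in> tableaux \<kappa>"
    and inj: "\<And>j. inj_on (\<lambda>b. row_in \<kappa> s (t b)) (column \<kappa> j)"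
  obtains \<pi> where "\<pi> \<in> column_stabilizer \<kappa> t" "tabloid_of \<kappa> s = perm_tabloid \<pi> (tabloid_of \<kappa> t)"
proof -
  let ?D = "diagram \<kappa>" and ?n = "sum_list \<kappa>"
  define r where "r b = row_in \<kappa> s (t b)" for b
  \<comment> \<open>the cell in the column of \<open>b\<close> that the tabloid prescribes for the entry at \<open>b\<close>\<close>
  define h where "h b = (r b, snd b)" for b
  have bt: "bij_betw t ?D {..<?n}" and bs: "bij_betw s ?D {..<?n}"
    using t s by (auto simp: tableaux_def)
  have "h ` ?D \<subseteq> ?D"
    using column_injective_head_eq[OF \<kappa> inj card_row_in[OF t s refl]] by (auto simp: h_def r_def)
  moreover have "inj_on h ?D"
  proof (rule inj_onI)
    fix b b' assume "b \<in> ?D" "b' \<in> ?D" "h b = h b'"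
    then show "b = b'" using inj[of "snd b"] by (auto simp: h_def r_def column_def dest: inj_onD)
  qed
  ultimately have bh: "bij_betw h ?D ?D" by (simp add: bij_betw_def endo_inj_surj)
  define \<pi> where "\<pi> x = (if x < ?n then (t \<circ> inv_into ?D h \<circ> inv_into ?D t) x else x)" for x
  have "bij_betw (t \<circ> inv_into ?D h \<circ> inv_into ?D t) {..<?n} {..<?n}"
    using bij_betw_inv_into[OF bt] bij_betw_inv_into[OF bh] bt by (auto intro: bij_betw_trans)
  then have "bij_betw \<pi> {..<?n} {..<?n}"
    by (rule bij_betw_cong[THEN iffD1, rotated]) (simp add: \<pi>_def)
  then have perm: "\<pi> permutes {..<?n}" by (rule bij_imp_permutes) (simp add: \<pi>_def)
  have \<pi>: "\<pi> (t (h b)) = t b" if "b \<in> ?D" for b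
  proof -
    have hb: "h b \<in> ?D" using bij_betwE[OF bh] that by auto
    then have "t (h b) < ?n" using bij_betwE[OF bt] by auto
    then show ?thesis
      using that hb bij_betw_inv_into_left[OF bt] bij_betw_inv_into_left[OF bh] by (simp add: \<pi>_def)
  qed
  have *: "\<pi> ` t ` {b \<in> ?D. P b} = t ` {b \<in> ?D. P (h b)}" for P
  proof -
    have "{b \<in> h ` ?D. P b} = h ` {b \<in> ?D. P (h b)}" by blast
    then have "{b \<in> ?D. P b} = h ` {b \<in> ?D. P (h b)}"
      by (simp only: bij_betw_imp_surj_on[OF bh])
    then have "\<pi> ` t ` {b \<in> ?D. P b} = (\<lambda>b. \<pi> (t (h b))) ` {b \<in> ?D. P (h b)}"
      by (simp add: image_comp o_def)
    then show ?thesis using \<pi> by auto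
  qed
  have "\<pi> \<in> column_stabilizer \<kappa> t"
    using perm *[of "\<lambda>b. snd b = _"] by (simp add: column_stabilizer_iff column_def h_def)
  moreover have "tabloid_of \<kappa> s = perm_tabloid \<pi> (tabloid_of \<kappa> t)"
  proof
    fix i
    have "s ` {c \<in> ?D. fst c = i} = t ` {b \<in> ?D. r b = i}"
    proof (intro set_eqI iffI)
      fix x assume "x \<in> s ` {c \<in> ?D. fst c = i}"
      then obtain c where c: "c \<in> ?D" "fst c = i" "x = s c" by auto
      then have "x \<in> t ` ?D" using bij_betwE[OF bs] bij_betw_imp_surj_on[OF bt] by auto
      then obtain b where "b \<in> ?D" "x = t b" by auto
      then show "x \<in> t ` {b \<in> ?D. r b = i}"
        using c bij_betw_inv_into_left[OF bs c(1)] by (auto simp: r_def row_in_def)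
    next
      fix x assume "x \<in> t ` {b \<in> ?D. r b = i}"
      then obtain b where b: "b \<in> ?D" "r b = i" "x = t b" by auto
      then have "x \<in> s ` ?D" using bij_betwE[OF bt] bij_betw_imp_surj_on[OF bs] by auto
      then have "x = s (inv_into ?D s x)" "inv_into ?D s x \<in> ?D"
        by (auto simp: f_inv_into_f inv_into_into)
      then show "x \<in> s ` {c \<in> ?D. fst c = i}"
        using b by (auto simp: r_def row_in_def)
    qed
    then show "tabloid_of \<kappa> s i = perm_tabloid \<pi> (tabloid_of \<kappa> t) i"
      using *[of "\<lambda>b. fst b = i"] by (simp add: tabloid_of_def perm_tabloid_def h_def)
  qed
  ultimately show ?thesis by (rule that)
qed

lemma row_column_stabilizer_trivial:
  assumes t: "t \<in> tableaux \<nu>" and \<sigma>: "\<sigma> \<in> column_stabilizer \<nu> t"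
    and fix_t: "perm_tabloid \<sigma> (tabloid_of \<nu> t) = tabloid_of \<nu> t"
  shows "\<sigma> = id"
proof
  fix x
  have inj: "inj_on t (diagram \<nu>)" and im: "t ` diagram \<nu> = {..<sum_list \<nu>}"
    using t by (auto simp: tableaux_def bij_betw_def)
  show "\<sigma> x = id x"
  proof (cases "x < sum_list \<nu>")
    case True
    then have "x \<in> t ` diagram \<nu>" by (simp add: im)
    then obtain b where b: "b \<in> diagram \<nu>" "x = t b" by blast
    have "\<sigma> x \<in> \<sigma> ` t ` column \<nu> (snd b)" using b by (auto simp: column_def)
    then have "\<sigma> x \<in> t ` column \<nu> (snd b)" using \<sigma> by (simp only: column_stabilizer_iff)
    then obtain c where c: "c \<in> diagram \<nu>" "snd c = snd b" "\<sigma> x = t c" by (auto simp: column_def)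
    have "\<sigma> x \<in> perm_tabloid \<sigma> (tabloid_of \<nu> t) (fst b)"
      using b by (auto simp: perm_tabloid_def tabloid_of_def)
    then have "\<sigma> x \<in> tabloid_of \<nu> t (fst b)" by (simp only: fix_t)
    then obtain d where d: "d \<in> diagram \<nu>" "fst d = fst b" "\<sigma> x = t d" by (auto simp: tabloid_of_def)
    have "c = d" using c d inj_onD[OF inj] by metis
    then have "c = b" using c d by (metis prod.expand)
    then show ?thesis using b c by simp
  next
    case False
    then show ?thesis using permutes_not_in[OF column_stabilizer_permutes[OF \<sigma>]] by simp
  qed
qed

text \<open>Only the identity preserves all rows and all columns, so no other term of the polytabloid
contributes to this coefficient.\<close>

lemma lookup_polytabloid:
  assumes "t \<in> tableaux \<nu>"
  shows "Poly_Mapping.lookup (polytabloid \<nu> t) (tabloid_of \<nu> t) = 1"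
proof -
  have "Poly_Mapping.lookup (polytabloid \<nu> t) (tabloid_of \<nu> t) =
     (\<Sum>\<sigma>\<in>column_stabilizer \<nu> t. if \<sigma> = id then 1 else 0)"
    unfolding polytabloid_def lookup_sum
    by (rule sum.cong [OF refl])
       (auto simp: lookup_single when_def sign_id dest: row_column_stabilizer_trivial[OF assms])
  then show ?thesis by simp
qed

text \<open>A tabloid of shape \<open>\<kappa>\<close> is either killed or of the form \<open>\<pi> {t}\<close> with \<open>\<pi>\<close> in the column stabilizer, and in
the second case it goes to \<open>sgn(\<pi>)\<close> times the polytabloid. The factor is recovered as the coefficient of
\<open>{t}\<close>.\<close>

lemma antisymmetrizer_rank_one:
  assumes \<kappa>: "\<kappa> \<in> Partitions" and t: "t \<in> tableaux \<kappa>" and v: "v \<in> perm_module \<kappa>"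
  shows "antisymmetrizer \<kappa> t (v :: tabloid \<Rightarrow>\<^sub>0 'a::field_char_0) =
     pm_scale (Poly_Mapping.lookup (antisymmetrizer \<kappa> t v) (tabloid_of \<kappa> t)) (polytabloid \<kappa> t)"
    (is "?A v = ?R v")
proof (rule pmp.linear_eq_on[of ?A ?R])
  show "pm_linear ?A" by (rule antisymmetrizer_linear)
  show "pm_linear ?R"
    by (rule pm_linearI)
       (simp_all add: pmp.linear_add[OF antisymmetrizer_linear] pmp.linear_scale[OF antisymmetrizer_linear]
         lookup_add pm.scale_left_distrib)
  show "v \<in> pm.span ((\<lambda>s. Poly_Mapping.single (tabloid_of \<kappa> s) 1) ` tableaux \<kappa>)"
    using v by (simp add: perm_module_def)
next
  fix v :: "tabloid \<Rightarrow>\<^sub>0 'a"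
  assume "v \<in> (\<lambda>s. Poly_Mapping.single (tabloid_of \<kappa> s) 1) ` tableaux \<kappa>"
  then obtain s where s: "s \<in> tableaux \<kappa>" "v = Poly_Mapping.single (tabloid_of \<kappa> s) 1" by auto
  show "?A v = ?R v"
  proof (cases "\<forall>j. inj_on (\<lambda>b. row_in \<kappa> s (t b)) (column \<kappa> j)")
    case False
    then have "?A v = 0" unfolding s(2) using antisymmetrizer_eq_0_if_not_inj[OF t s(1) refl] by blast
    then show ?thesis by simp
  next
    case True
    then obtain \<pi> where \<pi>: "\<pi> \<in> column_stabilizer \<kappa> t"
      "tabloid_of \<kappa> s = perm_tabloid \<pi> (tabloid_of \<kappa> t)"
      using tabloid_column_equivalent[OF \<kappa> t s(1)] by blast
    have "v = perm_action \<pi> (Poly_Mapping.single (tabloid_of \<kappa> t) 1)"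
      by (simp add: s(2) \<pi>(2))
    then have "?A v = pm_scale (of_int (sign \<pi>)) (polytabloid \<kappa> t)"
      by (simp only: antisymmetrizer_perm_action[OF \<pi>(1)] polytabloid_eq)
    then show ?thesis by (simp add: lookup_polytabloid[OF t])
  qed
qed

text \<open>The signed column sum is, up to the factor \<open>card (column_stabilizer \<nu> t)\<close>, an idempotent, and the polytabloid
lies in its image.\<close>

lemma antisymmetrizer_polytabloid:
  "antisymmetrizer \<nu> t (polytabloid \<nu> t) =
     pm_scale (of_nat (card (column_stabilizer \<nu> t))) (polytabloid \<nu> t :: tabloid \<Rightarrow>\<^sub>0 'a::field)"
proof -
  let ?s = "Poly_Mapping.single (tabloid_of \<nu> t) (1::'a)"
  have "antisymmetrizer \<nu> t (polytabloid \<nu> t) = (\<Sum>\<sigma>\<in>column_stabilizer \<nu> t.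
      pm_scale (of_int (sign \<sigma>)) (antisymmetrizer \<nu> t (perm_action \<sigma> ?s)))"
    unfolding polytabloid_eq by (subst (2) antisymmetrizer_def)
      (simp only: pmp.linear_sum[OF antisymmetrizer_linear] pmp.linear_scale[OF antisymmetrizer_linear])
  also have "\<dots> = (\<Sum>\<sigma>\<in>column_stabilizer \<nu> t. polytabloid \<nu> t)"
  proof (rule sum.cong [OF refl])
    fix \<sigma> assume \<sigma>: "\<sigma> \<in> column_stabilizer \<nu> t"
    have "of_int (sign \<sigma>) * of_int (sign \<sigma>) = (1::'a)" by (auto simp: sign_def)
    then show "pm_scale (of_int (sign \<sigma>)) (antisymmetrizer \<nu> t (perm_action \<sigma> ?s)) = polytabloid \<nu> t"
      by (simp only: antisymmetrizer_perm_action[OF \<sigma>] pm.scale_scale polytabloid_eq[symmetric] pm.scale_one)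
  qed
  finally show ?thesis by (simp only: pm.sum_constant_scale)
qed

section \<open>Specht modules and their characters\<close>

lemma polytabloid_in_perm_module:
  assumes t: "t \<in> tableaux \<nu>"
  shows "polytabloid \<nu> t \<in> (perm_module \<nu> :: (tabloid \<Rightarrow>\<^sub>0 'a::field) set)"
proof -
  have "Poly_Mapping.single (perm_tabloid \<sigma> (tabloid_of \<nu> t)) (of_int (sign \<sigma>) :: 'a) \<in> perm_module \<nu>"
    if \<sigma>: "\<sigma> \<in> column_stabilizer \<nu> t" for \<sigma>
  proof -
    have "\<sigma> \<circ> t \<in> tableaux \<nu>"
      using t column_stabilizer_permutes[OF \<sigma>] by (rule comp_in_tableaux)
    then have "pm_scale (of_int (sign \<sigma>)) (Poly_Mapping.single (tabloid_of \<nu> (\<sigma> \<circ> t)) (1::'a)) \<in> perm_module \<nu>"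
      unfolding perm_module_def by (intro pm.span_scale pm.span_base imageI)
    then show ?thesis by (simp add: tabloid_of_comp)
  qed
  then show ?thesis
    unfolding polytabloid_def perm_module_def by (intro pm.span_sum) (simp add: perm_module_def)
qed

lemma specht_subset_perm_module: "specht \<nu> \<subseteq> perm_module \<nu>"
  unfolding specht_def using polytabloid_in_perm_module
  by (intro pm.span_minimal) (auto simp: perm_module_def)

lemma finite_dim_specht: "finite_dim (specht \<nu>)"
proof -
  let ?S = "(\<lambda>T. Poly_Mapping.single T 1) ` tabloid_of \<nu> ` tableaux \<nu>"
  have "specht \<nu> \<subseteq> pm.span ?S"
    using specht_subset_perm_module[of \<nu>] by (simp add: perm_module_def image_image)
  moreover have "finite ?S" by (intro finite_imageI finite_tabloids)
  ultimately show ?thesis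
    unfolding finite_dim_def specht_def by (blast intro: pm.subspace_span)
qed

lemma polytabloid_in_specht: "t \<in> tableaux \<nu> \<Longrightarrow> polytabloid \<nu> t \<in> specht \<nu>"
  unfolding specht_def by (intro pm.span_base imageI)

lemma conjugate_in_column_stabilizer:
  assumes \<pi>: "\<pi> permutes {..<sum_list \<nu>}" and \<sigma>: "\<sigma> \<in> column_stabilizer \<nu> t"
  shows "\<pi> \<circ> \<sigma> \<circ> inv \<pi> \<in> column_stabilizer \<nu> (\<pi> \<circ> t)"
proof -
  have "(\<pi> \<circ> \<sigma> \<circ> inv \<pi>) ` (\<pi> \<circ> t) ` column \<nu> j = (\<pi> \<circ> t) ` column \<nu> j" for j
  proof -
    have "(\<pi> \<circ> \<sigma> \<circ> inv \<pi>) ` (\<pi> \<circ> t) ` column \<nu> j = \<pi> ` \<sigma> ` inv \<pi> ` \<pi> ` t ` column \<nu> j"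
      by (simp only: image_comp o_assoc)
    also have "inv \<pi> ` \<pi> ` t ` column \<nu> j = t ` column \<nu> j"
      using permutes_inj[OF \<pi>] by (rule image_inv_f_f)
    also have "\<sigma> ` t ` column \<nu> j = t ` column \<nu> j"
      using \<sigma> by (simp add: column_stabilizer_iff)
    finally show ?thesis by (simp only: image_comp)
  qed
  moreover have "\<pi> \<circ> \<sigma> \<circ> inv \<pi> permutes {..<sum_list \<nu>}"
    by (intro permutes_compose permutes_inv \<pi> column_stabilizer_permutes[OF \<sigma>])
  ultimately show ?thesis by (simp only: column_stabilizer_iff) simp
qed

text \<open>Conjugation by \<open>\<pi>\<close> carries the column stabilizer of \<open>t\<close> to that of \<open>\<pi> \<circ> t\<close> and preserves signs.\<close>

lemma perm_action_polytabloid: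
  assumes \<pi>: "\<pi> permutes {..<sum_list \<nu>}"
  shows "perm_action \<pi> (polytabloid \<nu> t) = (polytabloid \<nu> (\<pi> \<circ> t) :: tabloid \<Rightarrow>\<^sub>0 'a::field)"
proof -
  let ?K = "column_stabilizer \<nu>"
  have inv_o: "\<pi> \<circ> inv \<pi> = id" "inv \<pi> \<circ> \<pi> = id" using permutes_inv_o[OF \<pi>] by auto
  have inv_inv: "inv (inv \<pi>) = \<pi>" using permutes_inv_inv[OF \<pi>] .
  have cancel: "f \<circ> \<pi> \<circ> inv \<pi> = f" "f \<circ> inv \<pi> \<circ> \<pi> = f" for f :: "nat \<Rightarrow> nat"
    by (simp_all add: o_assoc[symmetric] inv_o)
  have cancel': "\<pi> \<circ> (inv \<pi> \<circ> f) = f" "inv \<pi> \<circ> (\<pi> \<circ> f) = f" for f :: "nat \<Rightarrow> nat"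
    by (simp_all add: o_assoc inv_o)
  have unconj: "inv \<pi> \<circ> \<rho> \<circ> \<pi> \<in> ?K t" if "\<rho> \<in> ?K (\<pi> \<circ> t)" for \<rho>
    using conjugate_in_column_stabilizer[OF permutes_inv[OF \<pi>] that]
    by (simp add: o_assoc inv_o inv_inv)
  have sgn: "sign (\<pi> \<circ> \<sigma> \<circ> inv \<pi>) = sign \<sigma>" if "\<sigma> \<in> ?K t" for \<sigma>
  proof -
    have p: "permutation \<pi>" "permutation \<sigma>" "permutation (inv \<pi>)"
      using \<pi> permutes_inv[OF \<pi>] column_stabilizer_permutation[OF that] permutes_finite_permutation by auto
    have "sign (\<pi> \<circ> \<sigma> \<circ> inv \<pi>) = sign \<pi> * sign \<sigma> * sign \<pi>"
      using p by (simp add: sign_compose permutation_compose sign_inverse)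
    then show ?thesis by (auto simp: sign_def)
  qed
  have "perm_action \<pi> (polytabloid \<nu> t) = (\<Sum>\<sigma>\<in>?K t.
     Poly_Mapping.single (perm_tabloid (\<pi> \<circ> \<sigma>) (tabloid_of \<nu> t)) (of_int (sign \<sigma>) :: 'a))"
    unfolding polytabloid_def pmp.linear_sum[OF perm_action_linear]
    by (simp only: perm_action_single perm_tabloid_comp)
  also have "\<dots> = (\<Sum>\<rho>\<in>?K (\<pi> \<circ> t).
     Poly_Mapping.single (perm_tabloid (\<rho> \<circ> \<pi>) (tabloid_of \<nu> t)) (of_int (sign \<rho>)))"
    by (rule sum.reindex_bij_witness[of _ "\<lambda>\<rho>. inv \<pi> \<circ> \<rho> \<circ> \<pi>" "\<lambda>\<sigma>. \<pi> \<circ> \<sigma> \<circ> inv \<pi>"])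
       (simp_all add: cancel cancel' comp_assoc inv_o conjugate_in_column_stabilizer[OF \<pi>, unfolded comp_assoc]
         unconj[unfolded comp_assoc] sgn[unfolded comp_assoc])
  also have "\<dots> = polytabloid \<nu> (\<pi> \<circ> t)"
    by (simp only: polytabloid_def tabloid_of_comp perm_tabloid_comp)
  finally show ?thesis .
qed

lemma perm_action_specht:
  assumes \<pi>: "\<pi> permutes {..<sum_list \<nu>}" and v: "v \<in> specht \<nu>"
  shows "perm_action \<pi> v \<in> specht \<nu>"
proof -
  have "perm_action \<pi> v \<in> perm_action \<pi> ` pm.span (polytabloid \<nu> ` tableaux \<nu>)"
    using v by (simp add: specht_def)
  also have "\<dots> = pm.span (perm_action \<pi> ` polytabloid \<nu> ` tableaux \<nu>)"
    by (rule pmp.linear_span_image[OF perm_action_linear, symmetric])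
  also have "\<dots> \<subseteq> specht \<nu>"
    unfolding specht_def using comp_in_tableaux[OF _ \<pi>]
    by (intro pm.span_mono) (auto simp: perm_action_polytabloid[OF \<pi>])
  finally show ?thesis .
qed

text \<open>If \<open>\<sigma> = \<tau> \<pi> \<tau>\<^sup>-\<^sup>1\<close>, the factor \<open>\<tau>\<close> can be moved to the other end under the trace.\<close>

lemma irr_char_class_function:
  assumes \<pi>: "\<pi> permutes {..<sum_list \<nu>}" and \<sigma>: "\<sigma> permutes {..<sum_list \<nu>}"
    and "cycle_type (sum_list \<nu>) \<pi> = cycle_type (sum_list \<nu>) \<sigma>"
  shows "irr_char \<nu> \<sigma> = (irr_char \<nu> \<pi> :: 'a::field_char_0)"
proof -
  obtain \<tau> where \<tau>: "\<tau> permutes {..<sum_list \<nu>}" and comm: "\<tau> \<circ> \<pi> = \<sigma> \<circ> \<tau>"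
    using cycle_type_eq_imp_conjugate[OF assms] by blast
  have inv_o: "\<tau> \<circ> inv \<tau> = id" "inv \<tau> \<circ> \<tau> = id" using permutes_inv_o[OF \<tau>] by auto
  have \<sigma>_eq: "\<sigma> = \<tau> \<circ> (\<pi> \<circ> inv \<tau>)"
    unfolding o_assoc comm by (simp add: o_assoc[symmetric] inv_o)
  have comp: "\<pi> \<circ> inv \<tau> permutes {..<sum_list \<nu>}"
    by (intro permutes_compose permutes_inv \<tau> \<pi>)
  have "irr_char \<nu> \<sigma> = trace_on (specht \<nu>) (\<lambda>v :: tabloid \<Rightarrow>\<^sub>0 'a. perm_action \<tau> (perm_action (\<pi> \<circ> inv \<tau>) v))"
    unfolding irr_char_def by (rule arg_cong[where f = "trace_on _"]) (simp add: \<sigma>_eq perm_action_comp fun_eq_iff)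
  also have "\<dots> = trace_on (specht \<nu>) (\<lambda>v. perm_action (\<pi> \<circ> inv \<tau>) (perm_action \<tau> v))"
    by (intro trace_on_commute finite_dim_specht perm_action_linear perm_action_specht \<tau> comp)
  also have "\<dots> = irr_char \<nu> \<pi>"
    unfolding irr_char_def perm_action_comp[symmetric]
    by (simp add: o_assoc[symmetric] inv_o)
  finally show ?thesis .
qed

lemma char_value_eq:
  assumes "\<pi> \<in> conj_class \<alpha>" "sum_list \<alpha> = sum_list \<nu>"
  shows "char_value \<nu> \<alpha> = irr_char \<nu> \<pi>"
proof -
  have "(SOME \<pi>. \<pi> \<in> conj_class \<alpha>) \<in> conj_class \<alpha>" 
    using assms(1) someI[of "\<lambda>\<pi>. \<pi> \<in> conj_class \<alpha>" \<pi>] by simp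
  with assms show ?thesis
    unfolding char_value_def by (intro irr_char_class_function) (auto simp: conj_class_def)
qed

lemma char_deg_eq_dim: "char_deg \<nu> = (of_nat (card (chosen_basis (specht \<nu> :: (tabloid \<Rightarrow>\<^sub>0 'a) set))) :: 'a::field_char_0)"
proof -
  have "char_deg \<nu> = (irr_char \<nu> id :: 'a)"
    unfolding char_deg_def
    by (rule char_value_eq[OF id_in_conj_class]) (simp add: sum_list_replicate)
  also have "\<dots> = trace_on (specht \<nu>) (\<lambda>v. v)"
    unfolding irr_char_def by (rule arg_cong[where f = "trace_on _"]) (simp add: fun_eq_iff)
  finally show ?thesis by (simp only: trace_on_id[OF finite_dim_specht])
qed

lemma card_specht_basis_pos: "card (chosen_basis (specht \<nu> :: (tabloid \<Rightarrow>\<^sub>0 'a::field) set)) > 0"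
proof -
  let ?B = "chosen_basis (specht \<nu> :: (tabloid \<Rightarrow>\<^sub>0 'a) set)"
  obtain t where t: "t \<in> tableaux \<nu>" using tableaux_nonempty by blast
  have "polytabloid \<nu> t \<noteq> (0 :: tabloid \<Rightarrow>\<^sub>0 'a)"
    using lookup_polytabloid[OF t, where ?'a = 'a] by auto
  moreover have "(polytabloid \<nu> t :: tabloid \<Rightarrow>\<^sub>0 'a) \<in> pm.span ?B"
    using polytabloid_in_specht[OF t] chosen_basis(2)[OF finite_dim_specht] by blast
  ultimately have "?B \<noteq> {}" by auto
  then show ?thesis using chosen_basis(3)[OF finite_dim_specht] by (simp add: card_gt_0_iff)
qed

text \<open>The degree is the dimension of a nonzero space, and positive integers do not vanish in characteristic 0.\<close>

lemma char_deg_ne_0: "char_deg \<nu> \<noteq> (0 :: 'a::field_char_0)"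
  using card_specht_basis_pos[of \<nu>, where ?'a = 'a] by (simp add: char_deg_eq_dim)

lemma char_deg_Nil: "char_deg [] = (1 :: 'a::field_char_0)"
proof -
  have "tabloid_of [] t = (\<lambda>_. {})" for t by (simp add: tabloid_of_def diagram_def)
  moreover have "column_stabilizer [] t = {id}" for t
    by (auto simp: column_stabilizer_iff column_def diagram_def permutes_id)
  ultimately have "polytabloid [] t = (Poly_Mapping.single (\<lambda>_. {}) 1 :: tabloid \<Rightarrow>\<^sub>0 'a)" for t
    by (simp add: polytabloid_def)
  then have *: "specht [] = pm.span {Poly_Mapping.single (\<lambda>_. {}) 1 :: tabloid \<Rightarrow>\<^sub>0 'a}"
    using tableaux_nonempty[of "[]"] unfolding specht_def by (metis (no_types, lifting) image_constant_conv image_cong)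
  have "card (chosen_basis (specht [] :: (tabloid \<Rightarrow>\<^sub>0 'a) set)) \<le> 1"
    using pm.independent_span_bound[of "{Poly_Mapping.single (\<lambda>_. {}) 1 :: tabloid \<Rightarrow>\<^sub>0 'a}"
        "chosen_basis (specht [])"] chosen_basis[OF finite_dim_specht[of "[]", where ?'a = 'a]]
      pm.span_superset unfolding * by auto
  then have "card (chosen_basis (specht [] :: (tabloid \<Rightarrow>\<^sub>0 'a) set)) = 1"
    using card_specht_basis_pos[of "[]", where ?'a = 'a] by simp
  then show ?thesis by (simp add: char_deg_eq_dim)
qed

section \<open>Linear independence of the characters\<close>

text \<open>The link between operators and characters: linear combinations of character values are traces
of elements of the group algebra.\<close>

lemma trace_antisymmetrizer:
  assumes n: "sum_list \<mu> = sum_list \<kappa>"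
  shows "(\<Sum>\<sigma>\<in>column_stabilizer \<kappa> t. of_int (sign \<sigma>) * irr_char \<mu> \<sigma>) =
    trace_on (specht \<mu>) (antisymmetrizer \<kappa> t :: (tabloid \<Rightarrow>\<^sub>0 'a::field_char_0) \<Rightarrow> _)"
proof -
  have "trace_on (specht \<mu>) (antisymmetrizer \<kappa> t :: (tabloid \<Rightarrow>\<^sub>0 'a) \<Rightarrow> _) =
    trace_on (specht \<mu>) (\<lambda>v. \<Sum>\<sigma>\<in>column_stabilizer \<kappa> t. pm_scale (of_int (sign \<sigma>)) (perm_action \<sigma> v))"
    by (rule arg_cong[where f = "trace_on _"]) (simp add: antisymmetrizer_def fun_eq_iff)
  also have "\<dots> = (\<Sum>\<sigma>\<in>column_stabilizer \<kappa> t. of_int (sign \<sigma>) * irr_char \<mu> \<sigma>)"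
    unfolding irr_char_def
    by (rule trace_on_sum[OF finite_dim_specht])
       (use n column_stabilizer_permutes in \<open>auto intro!: perm_action_specht\<close>)
  finally show ?thesis by simp
qed

lemma antisymmetrized_char_eq_0:
  assumes "\<kappa> \<in> Partitions" "t \<in> tableaux \<kappa>" "sum_list \<mu> = sum_list \<kappa>"
    and "\<not> head_size \<mu> i \<le> head_size \<kappa> i"
  shows "(\<Sum>\<sigma>\<in>column_stabilizer \<kappa> t. of_int (sign \<sigma>) * irr_char \<mu> \<sigma>) = (0 :: 'a::field_char_0)"
proof -
  have "antisymmetrizer \<kappa> t v = 0" if "v \<in> specht \<mu>" for v :: "tabloid \<Rightarrow>\<^sub>0 'a"
    using that specht_subset_perm_module by (intro antisymmetrizer_perm_module_eq_0[OF assms]) auto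
  then have "trace_on (specht \<mu>) (antisymmetrizer \<kappa> t :: (tabloid \<Rightarrow>\<^sub>0 'a) \<Rightarrow> _) = trace_on (specht \<mu>) (\<lambda>_. 0)"
    by (intro trace_on_cong finite_dim_specht)
  then show ?thesis by (simp add: trace_antisymmetrizer[OF assms(3)] trace_on_zero)
qed

lemma antisymmetrized_char_self:
  assumes \<kappa>: "\<kappa> \<in> Partitions" and t: "t \<in> tableaux \<kappa>"
  shows "(\<Sum>\<sigma>\<in>column_stabilizer \<kappa> t. of_int (sign \<sigma>) * irr_char \<kappa> \<sigma>) =
    (of_nat (card (column_stabilizer \<kappa> t)) :: 'a::field_char_0)"
proof -
  have "trace_on (specht \<kappa>) (antisymmetrizer \<kappa> t :: (tabloid \<Rightarrow>\<^sub>0 'a) \<Rightarrow> _) =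
    Poly_Mapping.lookup (antisymmetrizer \<kappa> t (polytabloid \<kappa> t)) (tabloid_of \<kappa> t)"
    using specht_subset_perm_module
    by (intro trace_on_rank_one finite_dim_specht antisymmetrizer_linear polytabloid_in_specht
        lookup_polytabloid t antisymmetrizer_rank_one[OF \<kappa> t]) auto
  then show ?thesis
    by (simp add: trace_antisymmetrizer antisymmetrizer_polytabloid lookup_polytabloid[OF t])
qed

text \<open>Triangularity: in a linear relation take a partition \<open>\<kappa>\<close> with nonzero coefficient that is minimal
in the dominance order and apply the functional \<open>\<Sum> sgn(\<sigma>) (\<cdot>)(\<sigma>)\<close> over the column stabilizer of a
tableau of shape \<open>\<kappa>\<close>. All terms except that of \<open>\<kappa>\<close> vanish.\<close>

lemma irr_chars_independent:
  fixes a :: "nat list \<Rightarrow> 'a::field_char_0"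
  assumes rel: "\<And>\<pi>. \<pi> permutes {..<n} \<Longrightarrow> (\<Sum>\<nu>\<in>partitions_of n. a \<nu> * irr_char \<nu> \<pi>) = 0"
    and \<nu>: "\<nu> \<in> partitions_of n"
  shows "a \<nu> = 0"
proof (rule ccontr)
  assume "a \<nu> \<noteq> 0"
  \<comment> \<open>a numerical weight that is strictly increasing in the dominance order, used to find a minimal element\<close>
  define W where "W \<mu> = (\<Sum>i\<le>n. head_size \<mu> i)" for \<mu>
  define S where "S = {\<mu> \<in> partitions_of n. a \<mu> \<noteq> 0}"
  have "\<nu> \<in> S" using \<nu> \<open>a \<nu> \<noteq> 0\<close> by (simp add: S_def)
  then obtain \<kappa> where \<kappa>S: "\<kappa> \<in> S" and min: "\<And>\<mu>. \<mu> \<in> S \<Longrightarrow> W \<kappa> \<le> W \<mu>"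
    using ex_has_least_nat[of "\<lambda>\<mu>. \<mu> \<in> S" \<nu> W] by blast
  then have \<kappa>n: "\<kappa> \<in> partitions_of n" and a\<kappa>: "a \<kappa> \<noteq> 0" by (auto simp: S_def)
  then have \<kappa>: "\<kappa> \<in> Partitions" "sum_list \<kappa> = n" by (auto simp: partitions_of_def)
  obtain t where t: "t \<in> tableaux \<kappa>" using tableaux_nonempty by blast
  let ?K = "column_stabilizer \<kappa> t"
  let ?s = "\<lambda>\<mu>. \<Sum>\<sigma>\<in>?K. of_int (sign \<sigma>) * (irr_char \<mu> \<sigma> :: 'a)"
  have other: "a \<mu> * ?s \<mu> = 0" if \<mu>: "\<mu> \<in> partitions_of n" "\<mu> \<noteq> \<kappa>" for \<mu>
  proof (cases "a \<mu> = 0")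
    case False
    have "\<exists>i. \<not> head_size \<mu> i \<le> head_size \<kappa> i"
    proof (rule ccontr)
      assume "\<not> ?thesis"
      then have le: "head_size \<mu> i \<le> head_size \<kappa> i" for i by blast
      have "W \<kappa> \<le> W \<mu>" using False \<mu> by (intro min) (simp add: S_def)
      moreover have "W \<mu> \<le> W \<kappa>" unfolding W_def by (intro sum_mono le)
      ultimately have eq: "W \<mu> = W \<kappa>" by simp
      have "head_size \<mu> i = head_size \<kappa> i" if "i \<le> n" for i
        using sum_mono_inv[OF eq[unfolded W_def]] le that by auto
      then have "\<mu> = \<kappa>" by (rule partition_eq_if_head_size_eq[OF \<mu>(1) \<kappa>n])
      with \<mu> show False by simp
    qed
    then obtain i where "\<not> head_size \<mu> i \<le> head_size \<kappa> i" ..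
    then have "?s \<mu> = 0"
      using \<mu> \<kappa> by (intro antisymmetrized_char_eq_0[OF \<kappa>(1) t]) (auto simp: partitions_of_def)
    then show ?thesis by simp
  qed simp
  have "0 = (\<Sum>\<sigma>\<in>?K. of_int (sign \<sigma>) * (\<Sum>\<mu>\<in>partitions_of n. a \<mu> * irr_char \<mu> \<sigma>))"
    using rel column_stabilizer_permutes \<kappa>(2) by (intro sum.neutral[symmetric]) force
  also have "\<dots> = (\<Sum>\<mu>\<in>partitions_of n. a \<mu> * ?s \<mu>)"
    by (simp add: sum_distrib_left sum.swap[of _ ?K] mult.left_commute)
  also have "\<dots> = (\<Sum>\<mu>\<in>{\<kappa>}. a \<mu> * ?s \<mu>)"
    using \<kappa>n other by (intro sum.mono_neutral_right) auto
  also have "\<dots> = a \<kappa> * of_nat (card ?K)"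
    by (simp add: antisymmetrized_char_self[OF \<kappa>(1) t])
  finally have "card ?K = 0" using a\<kappa> by simp
  moreover have "id \<in> ?K" by simp
  ultimately show False by (simp only: card_0_eq[OF finite_column_stabilizer]) blast
qed

lemma char_table_independent:
  fixes a :: "nat list \<Rightarrow> 'a::field_char_0"
  assumes rel: "\<And>\<alpha>. \<alpha> \<in> partitions_of n \<Longrightarrow> (\<Sum>\<nu>\<in>partitions_of n. a \<nu> * char_value \<nu> \<alpha>) = 0"
    and \<nu>: "\<nu> \<in> partitions_of n"
  shows "a \<nu> = 0"
proof (rule irr_chars_independent[OF _ \<nu>])
  fix \<pi> assume "\<pi> permutes {..<n}"
  then obtain \<alpha> where \<alpha>: "\<alpha> \<in> partitions_of n" "\<pi> \<in> conj_class \<alpha>"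
    by (rule permutes_cycle_type)
  have "(\<Sum>\<nu>\<in>partitions_of n. a \<nu> * irr_char \<nu> \<pi>) = (\<Sum>\<nu>\<in>partitions_of n. a \<nu> * char_value \<nu> \<alpha>)"
    using \<alpha> by (intro sum.cong refl) (simp add: char_value_eq partitions_of_def)
  then show "(\<Sum>\<nu>\<in>partitions_of n. a \<nu> * irr_char \<nu> \<pi>) = 0" using rel[OF \<alpha>(1)] by simp
qed

section \<open>The Schur functions form a basis\<close>

text \<open>The exponent vector of the monomial \<open>p\<^sub>\<alpha>\<close>; the entry at \<open>k\<close> is the multiplicity of the part \<open>k + 1\<close>.\<close>

definition power_exp :: "nat list \<Rightarrow> (nat \<Rightarrow>\<^sub>0 nat)" where
  "power_exp \<alpha> = (\<Sum>a\<leftarrow>\<alpha>. Poly_Mapping.single (a - 1) 1)"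

lemma power_sum_part_eq: "power_sum_part \<alpha> = Poly_Mapping.single (power_exp \<alpha>) 1"
  by (induction \<alpha>) (simp_all add: power_sum_part_def power_exp_def power_sum_def mult_single)

lemma lookup_power_exp:
  "0 \<notin> set \<alpha> \<Longrightarrow> Poly_Mapping.lookup (power_exp \<alpha>) k = count (mset \<alpha>) (Suc k)"
  by (induction \<alpha>) (auto simp: power_exp_def lookup_add lookup_single when_def)

lemma power_exp_inj: "inj_on power_exp Partitions"
proof (rule inj_onI)
  fix \<alpha> \<beta> assume \<alpha>: "\<alpha> \<in> Partitions" and \<beta>: "\<beta> \<in> Partitions" and eq: "power_exp \<alpha> = power_exp \<beta>"
  have 0: "0 \<notin> set \<alpha>" "0 \<notin> set \<beta>" using \<alpha> \<beta> by (auto simp: Partitions_def)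
  have "count (mset \<alpha>) k = count (mset \<beta>) k" for k
  proof (cases k)
    case 0
    then show ?thesis using \<open>0 \<notin> set \<alpha>\<close> \<open>0 \<notin> set \<beta>\<close> by (simp add: count_mset count_list_0_iff)
  next
    case (Suc j)
    then show ?thesis
      using lookup_power_exp[OF 0(1), of j] lookup_power_exp[OF 0(2), of j] eq by simp
  qed
  then have "mset \<alpha> = mset \<beta>" by (rule multiset_eqI)
  then show "\<alpha> = \<beta>" by (rule Partitions_mset_eq[OF \<alpha> \<beta>])
qed

lemma power_exp_surj: "\<exists>\<alpha>\<in>Partitions. power_exp \<alpha> = e"
proof -
  define M where "M = (\<Sum>k\<in>Poly_Mapping.keys e. replicate_mset (Poly_Mapping.lookup e k) (Suc k))"
  have "0 \<notin># M" by (auto simp: M_def set_mset_sum)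
  then obtain \<alpha> where \<alpha>: "\<alpha> \<in> Partitions" "mset \<alpha> = M" by (rule Partition_of_mset)
  have "count M (Suc k) = Poly_Mapping.lookup e k" for k
    by (auto simp: M_def count_sum in_keys_iff)
  then have "power_exp \<alpha> = e"
    using \<alpha> by (intro poly_mapping_eqI) (auto simp: lookup_power_exp Partitions_def)
  with \<alpha> show ?thesis by blast
qed

lemma partitions_of_subset: "partitions_of n \<subseteq> Partitions"
  by (auto simp: partitions_of_def)

lemma partitions_of_iff: "\<nu> \<in> partitions_of n \<longleftrightarrow> \<nu> \<in> Partitions \<and> sum_list \<nu> = n"
  by (auto simp: partitions_of_def)

lemma lookup_schur:
  assumes \<alpha>: "\<alpha> \<in> Partitions"
  shows "Poly_Mapping.lookup (schur \<nu>) (power_exp \<alpha>) =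
    (if sum_list \<alpha> = sum_list \<nu>
     then of_nat (card (conj_class \<alpha>)) / fact (sum_list \<nu>) * char_value \<nu> \<alpha>
     else (0 :: 'a::field_char_0))"
proof -
  let ?c = "\<lambda>\<beta>. of_nat (card (conj_class \<beta>)) / fact (sum_list \<nu>) * (char_value \<nu> \<beta> :: 'a)"
  have "Poly_Mapping.lookup (schur \<nu>) (power_exp \<alpha>) =
      (\<Sum>\<beta>\<in>partitions_of (sum_list \<nu>). if \<beta> = \<alpha> then ?c \<beta> else 0)"
    unfolding schur_def lookup_sum
  proof (rule sum.cong [OF refl])
    fix \<beta> assume "\<beta> \<in> partitions_of (sum_list \<nu>)"
    then have "power_exp \<beta> = power_exp \<alpha> \<longleftrightarrow> \<beta> = \<alpha>"
      using \<alpha> inj_onD[OF power_exp_inj, of \<beta> \<alpha>] by (auto simp: partitions_of_iff)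
    then show "Poly_Mapping.lookup (pm_scale (?c \<beta>) (power_sum_part \<beta>)) (power_exp \<alpha>) =
        (if \<beta> = \<alpha> then ?c \<beta> else 0)"
      by (simp add: power_sum_part_eq lookup_single when_def)
  qed
  also have "\<dots> = (if \<alpha> \<in> partitions_of (sum_list \<nu>) then ?c \<alpha> else 0)"
    by (rule sum.delta) simp
  finally show ?thesis using \<alpha> by (simp add: partitions_of_iff)
qed

text \<open>The coefficient of \<open>p\<^sub>\<alpha>\<close> in a relation between Schur functions involves only the partitions of
the size of \<open>\<alpha>\<close>, and is a nonzero multiple of the same relation between the values of the characters at \<open>\<alpha>\<close>.\<close>

lemma schur_relation_trivial:
  fixes c :: "nat list \<Rightarrow> 'a::field_char_0"
  assumes fin: "finite A" and A: "A \<subseteq> Partitions"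
    and rel: "(\<Sum>\<nu>\<in>A. pm_scale (c \<nu>) (schur \<nu>)) = 0" and \<nu>: "\<nu> \<in> A"
  shows "c \<nu> = 0"
proof -
  define n where "n = sum_list \<nu>"
  define a where "a \<mu> = (if \<mu> \<in> A then c \<mu> else 0)" for \<mu>
  have "a \<nu> = 0"
  proof (rule char_table_independent[where n = n])
    show "\<nu> \<in> partitions_of n" using \<nu> A by (auto simp: partitions_of_iff n_def)
  next
    fix \<alpha> assume \<alpha>: "\<alpha> \<in> partitions_of n"
    then have \<alpha>P: "\<alpha> \<in> Partitions" "sum_list \<alpha> = n" by (auto simp: partitions_of_iff)
    let ?k = "of_nat (card (conj_class \<alpha>)) / fact n :: 'a"
    have "0 = Poly_Mapping.lookup (\<Sum>\<mu>\<in>A. pm_scale (c \<mu>) (schur \<mu>)) (power_exp \<alpha>)"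
      by (simp add: rel)
    also have "\<dots> = (\<Sum>\<mu>\<in>A. c \<mu> * (if n = sum_list \<mu> then ?k * char_value \<mu> \<alpha> else 0))"
      unfolding lookup_sum
      by (intro sum.cong refl) (auto simp: lookup_schur[OF \<alpha>P(1)] \<alpha>P(2))
    also have "\<dots> = (\<Sum>\<mu>\<in>A \<inter> partitions_of n. ?k * (a \<mu> * char_value \<mu> \<alpha>))"
      using fin A by (intro sum.mono_neutral_cong_right) (auto simp: partitions_of_iff a_def)
    also have "\<dots> = (\<Sum>\<mu>\<in>partitions_of n. ?k * (a \<mu> * char_value \<mu> \<alpha>))"
      by (rule sum.mono_neutral_left) (auto simp: a_def)
    finally have "?k * (\<Sum>\<mu>\<in>partitions_of n. a \<mu> * char_value \<mu> \<alpha>) = 0"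
      by (simp add: sum_distrib_left)
    moreover have "card (conj_class \<alpha>) \<noteq> 0"
      using conj_class_nonempty[of \<alpha>] \<alpha>P(1) finite_conj_class[of \<alpha>] by (auto simp: Partitions_def)
    ultimately show "(\<Sum>\<mu>\<in>partitions_of n. a \<mu> * char_value \<mu> \<alpha>) = 0" by simp
  qed
  then show ?thesis using \<nu> by (simp add: a_def)
qed

lemma schur_inj: "inj_on (schur :: nat list \<Rightarrow> 'a::field_char_0 symfun) Partitions"
proof (rule inj_onI, rule ccontr)
  fix \<mu> \<nu> :: "nat list"
  assume *: "\<mu> \<in> Partitions" "\<nu> \<in> Partitions" "schur \<mu> = (schur \<nu> :: 'a symfun)" "\<mu> \<noteq> \<nu>"
  let ?c = "\<lambda>\<kappa>. if \<kappa> = \<mu> then 1 else - 1 :: 'a"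
  have "(\<Sum>\<kappa>\<in>{\<mu>, \<nu>}. pm_scale (?c \<kappa>) (schur \<kappa>)) = (0 :: 'a symfun)"
    using * by simp
  then have "?c \<mu> = 0" using * by (intro schur_relation_trivial[of "{\<mu>, \<nu>}" ?c]) auto
  then show False by simp
qed

lemma schur_independent: "pm.independent (schur ` Partitions :: 'a::field_char_0 symfun set)"
  unfolding pm.independent_explicit_module
proof (intro allI impI)
  fix t and u :: "'a symfun \<Rightarrow> 'a" and v
  assume t: "finite t" "t \<subseteq> schur ` Partitions" "(\<Sum>v\<in>t. pm_scale (u v) v) = 0" "v \<in> t"
  obtain A where A: "A \<subseteq> Partitions" "t = schur ` A"
    using t(2) by (auto simp: subset_image_iff)
  have inj: "inj_on (schur :: _ \<Rightarrow> 'a symfun) A" using schur_inj A(1) by (rule inj_on_subset)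
  have "finite A" using t(1) A(2) inj by (simp add: finite_image_iff)
  moreover have "(\<Sum>\<nu>\<in>A. pm_scale (u (schur \<nu>)) (schur \<nu>)) = 0"
    using t(3) by (simp add: A(2) sum.reindex[OF inj])
  moreover obtain \<nu> where "\<nu> \<in> A" "v = schur \<nu>" using t(4) A(2) by auto
  ultimately show "u v = 0" using schur_relation_trivial[OF _ A(1), of "\<lambda>\<nu>. u (schur \<nu>)" \<nu>] by simp
qed

text \<open>A dimension count: the Schur functions of degree \<open>n\<close> are independent and as numerous as the monomials
\<open>p\<^sub>\<alpha>\<close> that span them, so there is no room for a further independent vector.\<close>

lemma power_sum_part_in_span_schur:
  assumes "\<alpha> \<in> partitions_of n"
  shows "power_sum_part \<alpha> \<in> pm.span (schur ` partitions_of n :: 'a::field_char_0 symfun set)"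
proof (rule ccontr)
  let ?p = "power_sum_part \<alpha> :: 'a symfun"
  let ?S = "schur ` partitions_of n :: 'a symfun set"
  let ?P = "power_sum_part ` partitions_of n :: 'a symfun set"
  assume "?p \<notin> pm.span ?S"
  moreover have "pm.independent ?S"
    using schur_independent by (rule pm.independent_mono) (use partitions_of_subset in blast)
  ultimately have "pm.independent (insert ?p ?S)" by (rule pm.independent_insertI)
  moreover have "insert ?p ?S \<subseteq> pm.span ?P"
  proof -
    have "schur \<nu> \<in> pm.span ?P" if "\<nu> \<in> partitions_of n" for \<nu>
      using that unfolding schur_def
      by (intro pm.span_sum pm.span_scale pm.span_base) (auto simp: partitions_of_iff)
    moreover have "?p \<in> pm.span ?P" using assms by (intro pm.span_base) auto
    ultimately show ?thesis by blast
  qed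
  ultimately have "card (insert ?p ?S) \<le> card ?P"
    using pm.independent_span_bound[of ?P "insert ?p ?S"] by simp
  also have "\<dots> \<le> card (partitions_of n)" by (rule card_image_le) simp
  also have "\<dots> = card ?S"
    using inj_on_subset[OF schur_inj partitions_of_subset] by (intro card_image[symmetric])
  finally have "card (insert ?p ?S) \<le> card ?S" .
  moreover have "?p \<notin> ?S" using \<open>?p \<notin> pm.span ?S\<close> pm.span_base by blast
  ultimately show False by simp
qed

lemma span_schur: "pm.span (schur ` Partitions :: 'a::field_char_0 symfun set) = UNIV"
proof -
  let ?S = "schur ` Partitions :: 'a symfun set"
  have monomial: "Poly_Mapping.single e 1 \<in> pm.span ?S" for e
  proof -
    obtain \<alpha> where \<alpha>: "\<alpha> \<in> Partitions" "power_exp \<alpha> = e" using power_exp_surj by blast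
    then have "power_sum_part \<alpha> \<in> pm.span (schur ` partitions_of (sum_list \<alpha>) :: 'a symfun set)"
      by (intro power_sum_part_in_span_schur) (simp add: partitions_of_iff)
    also have "\<dots> \<subseteq> pm.span ?S" using partitions_of_subset by (intro pm.span_mono) blast
    finally show ?thesis by (simp add: power_sum_part_eq \<alpha>(2))
  qed
  have "v \<in> pm.span ?S" for v
  proof -
    have "(\<Sum>k\<in>Poly_Mapping.keys v. pm_scale (Poly_Mapping.lookup v k) (Poly_Mapping.single k 1)) \<in> pm.span ?S"
      by (intro pm.span_sum pm.span_scale monomial)
    then show ?thesis by (simp add: poly_mapping_sum_singles)
  qed
  then show ?thesis by blast
qed

lemma schur_expansion:
  fixes v :: "'a::field_char_0 symfun"
  obtains A c where "finite A" "A \<subseteq> Partitions" "v = (\<Sum>\<nu>\<in>A. pm_scale (c \<nu>) (schur \<nu>))"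
proof -
  have "v \<in> pm.span (schur ` Partitions)" by (simp add: span_schur)
  then obtain t r where t: "finite t" "t \<subseteq> schur ` Partitions" "v = (\<Sum>a\<in>t. pm_scale (r a) a)"
    by (auto simp: pm.span_explicit)
  obtain A where A: "A \<subseteq> Partitions" "t = schur ` A" using t(2) by (auto simp: subset_image_iff)
  have inj: "inj_on (schur :: _ \<Rightarrow> 'a symfun) A" using schur_inj A(1) by (rule inj_on_subset)
  show ?thesis
  proof (rule that)
    show "finite A" using t(1) A(2) inj by (simp add: finite_image_iff)
    show "v = (\<Sum>\<nu>\<in>A. pm_scale (r (schur \<nu>)) (schur \<nu>))"
      using t(3) by (simp add: A(2) sum.reindex[OF inj])
  qed (rule A(1))
qed

text \<open>This justifies the definite descriptions in the definitions of \<open>U_op\<close> and \<open>C_op\<close>.\<close>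

lemma ex1_linear_on_schur:
  fixes F :: "nat list \<Rightarrow> 'a::field_char_0 symfun"
  shows "\<exists>!T. pm_linear T \<and> (\<forall>\<nu>\<in>Partitions. T (schur \<nu>) = F \<nu>)"
proof (rule ex_ex1I)
  let ?B = "schur ` Partitions :: 'a symfun set"
  let ?T = "pmp.construct ?B (\<lambda>s. F (inv_into Partitions schur s))"
  show "\<exists>T. pm_linear T \<and> (\<forall>\<nu>\<in>Partitions. T (schur \<nu>) = F \<nu>)"
  proof (intro exI[of _ ?T] conjI ballI)
    show "pm_linear ?T" by (rule pmp.linear_construct[OF schur_independent])
    fix \<nu> assume "\<nu> \<in> Partitions"
    then show "?T (schur \<nu>) = F \<nu>"
      by (simp add: pmp.construct_basis[OF schur_independent] inv_into_f_f[OF schur_inj])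
  qed
next
  fix S T :: "'a symfun \<Rightarrow> 'a symfun"
  assume S: "pm_linear S \<and> (\<forall>\<nu>\<in>Partitions. S (schur \<nu>) = F \<nu>)"
    and T: "pm_linear T \<and> (\<forall>\<nu>\<in>Partitions. T (schur \<nu>) = F \<nu>)"
  show "S = T"
  proof
    fix v
    show "S v = T v"
      by (rule pmp.linear_eq_on[of S T v "schur ` Partitions"]) (use S T in \<open>auto simp: span_schur\<close>)
  qed
qed

lemma schur_Nil: "schur [] = (1 :: 'a::field_char_0 symfun)"
proof -
  have "partitions_of 0 = {[]}"
    using length_partition_le[of _ 0] by (auto simp: partitions_of_def Partitions_def)
  moreover have "conj_class [] = {id}"
    by (auto simp: conj_class_def permutes_id cycle_type_def)
  moreover have "char_value [] [] = (1::'a)"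
    using char_deg_Nil[where ?'a = 'a] by (simp add: char_deg_def)
  ultimately show ?thesis by (simp add: schur_def power_sum_part_def)
qed

lemma lookup_schur_0:
  assumes "\<nu> \<in> Partitions" "\<nu> \<noteq> []"
  shows "Poly_Mapping.lookup (schur \<nu>) 0 = (0 :: 'a::field_char_0)"
proof -
  have "sum_list \<nu> \<noteq> 0" using assms by (cases \<nu>) (auto simp: Partitions_def)
  moreover have "[] \<in> Partitions" by (simp add: Partitions_def)
  moreover have "power_exp [] = 0" by (simp add: power_exp_def)
  ultimately show ?thesis 
    using lookup_schur[of "[]" \<nu>, where ?'a = 'a] by (simp del: sum_list_eq_0_iff)
qed

section \<open>Adding and removing cells\<close>

lemma adds_cell_sum_list: "adds_cell \<nu> b \<mu> \<Longrightarrow> sum_list \<mu> = Suc (sum_list \<nu>)"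
  by (metis adds_cell_def card_diagram card_insert_disjoint finite_diagram)

definition cells_above :: "nat list \<Rightarrow> ((nat \<times> nat) \<times> nat list) set" where
  "cells_above \<nu> = {(b, \<mu>). adds_cell \<nu> b \<mu>}"

definition cells_below :: "nat list \<Rightarrow> ((nat \<times> nat) \<times> nat list) set" where
  "cells_below \<mu> = {(b, \<nu>). adds_cell \<nu> b \<mu>}"

lemma finite_cells_above: "finite (cells_above \<nu>)"
proof (rule finite_subset)
  let ?P = "partitions_of (Suc (sum_list \<nu>))"
  show "cells_above \<nu> \<subseteq> (\<Union>\<mu>\<in>?P. diagram \<mu>) \<times> ?P"
    using adds_cell_sum_list by (fastforce simp: cells_above_def adds_cell_def partitions_of_def)
qed simp

lemma finite_cells_below: "finite (cells_below \<mu>)"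
proof (rule finite_subset)
  show "cells_below \<mu> \<subseteq> diagram \<mu> \<times> partitions_of (sum_list \<mu> - 1)"
    using adds_cell_sum_list by (fastforce simp: cells_below_def adds_cell_def partitions_of_def)
qed simp

text \<open>The last cell of the last row can be removed; if it is alone in its row, the row disappears.\<close>

lemma cells_below_nonempty:
  assumes \<mu>: "\<mu> \<in> Partitions" and ne: "\<mu> \<noteq> []"
  shows "cells_below \<mu> \<noteq> {}"
proof -
  obtain \<alpha> k where \<mu>_eq: "\<mu> = \<alpha> @ [k]" using ne by (metis rev_exhaust)
  have k: "k > 0" and \<alpha>: "\<forall>a\<in>set \<alpha>. a \<ge> k" "sorted_wrt (\<ge>) \<alpha>" "0 \<notin> set \<alpha>"
    using \<mu> by (auto simp: \<mu>_eq Partitions_def sorted_wrt_append)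
  let ?b = "(length \<alpha>, k - 1)"
  let ?\<nu> = "if k = 1 then \<alpha> else \<alpha> @ [k - 1]"
  have "?\<nu> \<in> Partitions"
    using \<alpha> k by (auto simp: Partitions_def sorted_wrt_append)
  moreover have "?b \<notin> diagram ?\<nu>" by (auto simp: diagram_def nth_append)
  moreover have "diagram \<mu> = insert ?b (diagram ?\<nu>)"
    using k by (auto simp: \<mu>_eq diagram_def nth_append less_Suc_eq split: if_splits)
  ultimately have "(?b, ?\<nu>) \<in> cells_below \<mu>"
    using \<mu> by (simp add: cells_below_def adds_cell_def)
  then show ?thesis by blast
qed

section \<open>The operators on the Schur basis\<close>

lemma U_op:
  shows U_op_linear: "pm_linear (U_op k :: 'a::field_char_0 symfun \<Rightarrow> 'a symfun)"
    and U_op_schur: "\<nu> \<in> Partitions \<Longrightarrow> U_op k (schur \<nu>) =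
      (\<Sum>(b, \<mu>)\<in>cells_above \<nu>. pm_scale (of_int (content b) ^ k) (schur \<mu> :: 'a symfun))"
  using theI'[OF ex1_linear_on_schur[where F =
        "\<lambda>\<nu>. \<Sum>(b, \<mu>)\<in>cells_above \<nu>. pm_scale (of_int (content b) ^ k) (schur \<mu> :: 'a symfun)"]]
  by (simp_all add: U_op_def cells_above_def)

definition C_eigenvalue :: "nat \<Rightarrow> nat list \<Rightarrow> 'a::field_char_0" where
  "C_eigenvalue k \<mu> = of_nat (sum_list \<mu>) / char_deg \<mu> *
     (\<Sum>(b, \<nu>)\<in>cells_below \<mu>. of_int (content b) ^ k * char_deg \<nu>)"

lemma C_op:
  shows C_op_linear: "pm_linear (C_op k :: 'a::field_char_0 symfun \<Rightarrow> 'a symfun)"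
    and C_op_schur: "\<mu> \<in> Partitions \<Longrightarrow>
      C_op k (schur \<mu>) = pm_scale (C_eigenvalue k \<mu>) (schur \<mu> :: 'a symfun)"
  using theI'[OF ex1_linear_on_schur[where F =
        "\<lambda>\<mu>. pm_scale (C_eigenvalue k \<mu>) (schur \<mu> :: 'a symfun)"]]
  by (simp_all add: C_op_def C_eigenvalue_def cells_below_def)

text \<open>For \<open>k = 0\<close> the contents drop out and the sum is one of positive dimensions, nonzero in
characteristic 0.\<close>

lemma C_eigenvalue_0_ne_0:
  assumes \<mu>: "\<mu> \<in> Partitions" "\<mu> \<noteq> []"
  shows "C_eigenvalue 0 \<mu> \<noteq> (0 :: 'a::field_char_0)"
proof -
  let ?d = "\<lambda>\<nu>. card (chosen_basis (specht \<nu> :: (tabloid \<Rightarrow>\<^sub>0 'a) set))"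
  have "(\<Sum>(b, \<nu>)\<in>cells_below \<mu>. of_int (content b) ^ 0 * char_deg \<nu>) =
      (of_nat (\<Sum>(b, \<nu>)\<in>cells_below \<mu>. ?d \<nu>) :: 'a)"
    by (simp add: char_deg_eq_dim case_prod_unfold)
  moreover have "(\<Sum>(b, \<nu>)\<in>cells_below \<mu>. ?d \<nu>) > 0"
    using finite_cells_below cells_below_nonempty[OF \<mu>]
    by (intro sum_pos) (simp_all add: case_prod_unfold card_specht_basis_pos)
  moreover have "sum_list \<mu> \<noteq> 0" using \<mu> by (cases \<mu>) (auto simp: Partitions_def)
  ultimately show ?thesis
    unfolding C_eigenvalue_def by (simp add: char_deg_ne_0 del: sum_list_eq_0_iff of_nat_sum)
qed

text \<open>The kernel of \<open>C\<^sub>0\<close> is spanned by \<open>s\<^bsub>[]\<^esub> = 1\<close>, that is, it consists of the constants.\<close>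

lemma C_op_0_injective:
  fixes v :: "'a::field_char_0 symfun"
  assumes C: "C_op 0 v = 0" and v0: "Poly_Mapping.lookup v 0 = 0"
  shows "v = 0"
proof -
  obtain A c where A: "finite A" "A \<subseteq> Partitions" and v: "v = (\<Sum>\<nu>\<in>A. pm_scale (c \<nu>) (schur \<nu>))"
    by (rule schur_expansion)
  have "(\<Sum>\<nu>\<in>A. pm_scale (c \<nu> * C_eigenvalue 0 \<nu>) (schur \<nu>)) = C_op 0 v"
    unfolding v pmp.linear_sum[OF C_op_linear]
    using A(2) by (intro sum.cong refl) (auto simp: pmp.linear_scale[OF C_op_linear] C_op_schur)
  then have "c \<nu> * C_eigenvalue 0 \<nu> = 0" if "\<nu> \<in> A" for \<nu>
    using that C by (intro schur_relation_trivial[OF A]) simp_all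
  then have c: "c \<nu> = 0" if "\<nu> \<in> A" "\<nu> \<noteq> []" for \<nu>
    using that A(2) C_eigenvalue_0_ne_0[of \<nu>, where ?'a = 'a] by auto
  have "v = (\<Sum>\<nu>\<in>A. if \<nu> = [] then pm_scale (c []) 1 else 0)"
    unfolding v using c by (intro sum.cong refl) (auto simp: schur_Nil)
  also have "\<dots> = (if [] \<in> A then pm_scale (c []) 1 else 0)"
    using A(1) by (rule sum.delta)
  finally have v_eq: "v = (if [] \<in> A then pm_scale (c []) 1 else 0)" .
  then have "[] \<in> A \<Longrightarrow> c [] = 0" using v0 by (simp add: lookup_one)
  then show ?thesis using v_eq by simp
qed

section \<open>Coefficients of the content series\<close>

text \<open>The coefficient of \<open>z\<^sup>n s\<^sub>\<nu>\<close> in the content series, a power series in \<open>y\<close>.\<close>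

definition content_weight :: "'a::field_char_0 fps \<Rightarrow> nat list \<Rightarrow> 'a fps" where
  "content_weight h \<nu> = fps_const (char_deg \<nu> / fact (sum_list \<nu>)) *
     (\<Prod>b\<in>diagram \<nu>. h oo (fps_const (of_int (content b)) * fps_X))"

lemma content_series_nth:
  "content_series h $ n $ m = (\<Sum>\<nu>\<in>partitions_of n. pm_scale (content_weight h \<nu> $ m) (schur \<nu>))"
  unfolding content_series_def fps_nth_Abs_fps fps_sum_nth
  by (intro sum.cong refl)
     (simp add: const_fps_def content_weight_def partitions_of_def pm_scale_eq_mult)

lemma op_series_nth:
  "op_series f T \<Psi> $ n $ m = (\<Sum>i\<le>m. pm_scale (f $ i) (T i (\<Psi> $ n $ (m - i))))"
  by (simp add: op_series_def)

lemma twist_mult_nth: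
  "((f oo (fps_const c * fps_X)) * w) $ m = (\<Sum>i\<le>m. f $ i * c ^ i * w $ (m - i))"
  for f w :: "'a::field fps"
  by (simp add: fps_mult_nth fps_compose_linear atMost_atLeast0 mult.commute[of "c ^ _"])

lemma op_series_U_nth:
  "op_series f U_op (content_series h) $ n $ m =
     (\<Sum>\<nu>\<in>partitions_of n. \<Sum>(b, \<mu>)\<in>cells_above \<nu>.
        pm_scale (((f oo (fps_const (of_int (content b)) * fps_X)) * content_weight h \<nu>) $ m) (schur \<mu>))"
proof -
  have "op_series f U_op (content_series h) $ n $ m =
    (\<Sum>i\<le>m. \<Sum>\<nu>\<in>partitions_of n. \<Sum>(b, \<mu>)\<in>cells_above \<nu>.
       pm_scale (f $ i * of_int (content b) ^ i * content_weight h \<nu> $ (m - i)) (schur \<mu>))"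
    unfolding op_series_nth content_series_nth
  proof (rule sum.cong [OF refl])
    fix i
    have "U_op i (\<Sum>\<nu>\<in>partitions_of n. pm_scale (content_weight h \<nu> $ (m - i)) (schur \<nu>)) =
      (\<Sum>\<nu>\<in>partitions_of n. pm_scale (content_weight h \<nu> $ (m - i))
        (\<Sum>(b, \<mu>)\<in>cells_above \<nu>. pm_scale (of_int (content b) ^ i) (schur \<mu>)))"
      unfolding pmp.linear_sum[OF U_op_linear] pmp.linear_scale[OF U_op_linear]
      by (intro sum.cong refl) (simp add: U_op_schur partitions_of_iff)
    then show "pm_scale (f $ i) (U_op i (\<Sum>\<nu>\<in>partitions_of n. pm_scale (content_weight h \<nu> $ (m - i)) (schur \<nu>))) =
      (\<Sum>\<nu>\<in>partitions_of n. \<Sum>(b, \<mu>)\<in>cells_above \<nu>.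
       pm_scale (f $ i * of_int (content b) ^ i * content_weight h \<nu> $ (m - i)) (schur \<mu>))"
      by (simp add: pm.scale_sum_right case_prod_unfold mult_ac)
  qed
  also have "\<dots> = (\<Sum>\<nu>\<in>partitions_of n. \<Sum>(b, \<mu>)\<in>cells_above \<nu>. \<Sum>i\<le>m.
       pm_scale (f $ i * of_int (content b) ^ i * content_weight h \<nu> $ (m - i)) (schur \<mu>))"
    by (subst sum.swap, intro sum.cong refl, subst sum.swap) (simp add: case_prod_unfold)
  also have "\<dots> = (\<Sum>\<nu>\<in>partitions_of n. \<Sum>(b, \<mu>)\<in>cells_above \<nu>.
        pm_scale (((f oo (fps_const (of_int (content b)) * fps_X)) * content_weight h \<nu>) $ m) (schur \<mu>))"
    by (simp only: twist_mult_nth pm.scale_sum_left)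
  finally show ?thesis .
qed

lemma op_series_C_nth:
  "op_series g C_op (content_series h) $ n $ m =
     (\<Sum>\<mu>\<in>partitions_of n. \<Sum>(b, \<nu>)\<in>cells_below \<mu>.
        pm_scale ((fps_const (of_nat n / char_deg \<mu> * char_deg \<nu>) *
          ((g oo (fps_const (of_int (content b)) * fps_X)) * content_weight h \<mu>)) $ m) (schur \<mu>))"
proof -
  have "op_series g C_op (content_series h) $ n $ m =
    (\<Sum>i\<le>m. \<Sum>\<mu>\<in>partitions_of n. \<Sum>(b, \<nu>)\<in>cells_below \<mu>.
       pm_scale (of_nat n / char_deg \<mu> * char_deg \<nu> *
         (g $ i * of_int (content b) ^ i * content_weight h \<mu> $ (m - i))) (schur \<mu>))"
    unfolding op_series_nth content_series_nth
  proof (rule sum.cong [OF refl])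
    fix i
    have "C_op i (\<Sum>\<mu>\<in>partitions_of n. pm_scale (content_weight h \<mu> $ (m - i)) (schur \<mu>)) =
      (\<Sum>\<mu>\<in>partitions_of n. pm_scale (content_weight h \<mu> $ (m - i)) (pm_scale (C_eigenvalue i \<mu>) (schur \<mu>)))"
      unfolding pmp.linear_sum[OF C_op_linear] pmp.linear_scale[OF C_op_linear]
      by (intro sum.cong refl) (simp add: C_op_schur partitions_of_iff)
    then have "pm_scale (g $ i) (C_op i (\<Sum>\<mu>\<in>partitions_of n. pm_scale (content_weight h \<mu> $ (m - i)) (schur \<mu>))) =
      (\<Sum>\<mu>\<in>partitions_of n. pm_scale (g $ i * content_weight h \<mu> $ (m - i) * C_eigenvalue i \<mu>) (schur \<mu>))"
      by (simp add: pm.scale_sum_right mult.assoc)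
    also have "\<dots> = (\<Sum>\<mu>\<in>partitions_of n. \<Sum>(b, \<nu>)\<in>cells_below \<mu>.
       pm_scale (of_nat n / char_deg \<mu> * char_deg \<nu> *
         (g $ i * of_int (content b) ^ i * content_weight h \<mu> $ (m - i))) (schur \<mu>))"
    proof (rule sum.cong [OF refl])
      fix \<mu> assume "\<mu> \<in> partitions_of n"
      then have n: "sum_list \<mu> = n" by (simp add: partitions_of_iff)
      have "g $ i * content_weight h \<mu> $ (m - i) * C_eigenvalue i \<mu> =
        (\<Sum>(b, \<nu>)\<in>cells_below \<mu>. of_nat n / char_deg \<mu> * char_deg \<nu> *
         (g $ i * of_int (content b) ^ i * content_weight h \<mu> $ (m - i)))"
        unfolding C_eigenvalue_def sum_distrib_left n
        by (intro sum.cong refl) (simp add: case_prod_unfold mult_ac)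
      then show "pm_scale (g $ i * content_weight h \<mu> $ (m - i) * C_eigenvalue i \<mu>) (schur \<mu>) =
        (\<Sum>(b, \<nu>)\<in>cells_below \<mu>. pm_scale (of_nat n / char_deg \<mu> * char_deg \<nu> *
         (g $ i * of_int (content b) ^ i * content_weight h \<mu> $ (m - i))) (schur \<mu>))"
        by (simp only: pm.scale_sum_left case_prod_unfold)
    qed
    finally show "pm_scale (g $ i) (C_op i (\<Sum>\<mu>\<in>partitions_of n. pm_scale (content_weight h \<mu> $ (m - i)) (schur \<mu>))) =
      (\<Sum>\<mu>\<in>partitions_of n. \<Sum>(b, \<nu>)\<in>cells_below \<mu>.
       pm_scale (of_nat n / char_deg \<mu> * char_deg \<nu> *
         (g $ i * of_int (content b) ^ i * content_weight h \<mu> $ (m - i))) (schur \<mu>))" .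
  qed
  also have "\<dots> = (\<Sum>\<mu>\<in>partitions_of n. \<Sum>(b, \<nu>)\<in>cells_below \<mu>. \<Sum>i\<le>m.
       pm_scale (of_nat n / char_deg \<mu> * char_deg \<nu> *
         (g $ i * of_int (content b) ^ i * content_weight h \<mu> $ (m - i))) (schur \<mu>))"
    by (subst sum.swap, intro sum.cong refl, subst sum.swap) (simp add: case_prod_unfold)
  also have "\<dots> = (\<Sum>\<mu>\<in>partitions_of n. \<Sum>(b, \<nu>)\<in>cells_below \<mu>.
        pm_scale ((fps_const (of_nat n / char_deg \<mu> * char_deg \<nu>) *
          ((g oo (fps_const (of_int (content b)) * fps_X)) * content_weight h \<mu>)) $ m) (schur \<mu>))"
    by (simp only: fps_mult_left_const_nth twist_mult_nth sum_distrib_left pm.scale_sum_left)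
  finally show ?thesis .
qed

text \<open>The computation behind the equation. Passing from \<open>\<nu>\<close> to \<open>\<mu>\<close> multiplies the product over the
cells by \<open>(f / g)(y c(b))\<close>; the factor \<open>g(y c(b))\<close> cancels the denominator, and the quotient of degrees
together with \<open>n + 1\<close> turns \<open>\<chi>\<^sup>\<mu>(1) / (n + 1)!\<close> into \<open>\<chi>\<^sup>\<nu>(1) / n!\<close>.\<close>

lemma content_weight_step:
  fixes f g :: "'a::field_char_0 fps"
  assumes g0: "g $ 0 \<noteq> 0" and cell: "adds_cell \<nu> b \<mu>" and n: "sum_list \<mu> = Suc n"
  shows "fps_const (of_nat (Suc n) / char_deg \<mu> * char_deg \<nu>) *
      ((g oo (fps_const (of_int (content b)) * fps_X)) * content_weight (f * inverse g) \<mu>)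
    = (f oo (fps_const (of_int (content b)) * fps_X)) * content_weight (f * inverse g) \<nu>"
proof -
  let ?tw = "\<lambda>h b. h oo (fps_const (of_int (content b)) * fps_X) :: 'a fps"
  let ?h = "f * inverse g"
  have \<nu>n: "sum_list \<nu> = n" using adds_cell_sum_list[OF cell] n by simp
  have gh_f: "g * ?h = f" using inverse_mult_eq_1[OF g0] by (simp add: mult.left_commute mult.commute[of g])
  have "?tw g b * ?tw ?h b = ?tw (g * ?h) b"
    by (rule fps_compose_mult_distrib[symmetric]) simp
  then have gh: "?tw g b * ?tw ?h b = ?tw f b" by (simp only: gh_f)
  have "(\<Prod>b\<in>diagram \<mu>. ?tw ?h b) = ?tw ?h b * (\<Prod>b\<in>diagram \<nu>. ?tw ?h b)"
    using cell by (simp add: adds_cell_def)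
  then have "fps_const (of_nat (Suc n) / char_deg \<mu> * char_deg \<nu>) * (?tw g b * content_weight ?h \<mu>)
    = fps_const (of_nat (Suc n) / char_deg \<mu> * char_deg \<nu>) * fps_const (char_deg \<mu> / fact (Suc n)) *
      ((?tw g b * ?tw ?h b) * (\<Prod>b\<in>diagram \<nu>. ?tw ?h b))"
    by (simp only: content_weight_def n mult_ac)
  also have "fps_const (of_nat (Suc n) / char_deg \<mu> * char_deg \<nu>) * fps_const (char_deg \<mu> / fact (Suc n))
    = (fps_const (char_deg \<nu> / fact n) :: 'a fps)"
  proof -
    have "of_nat (Suc n) / char_deg \<mu> * char_deg \<nu> * (char_deg \<mu> / fact (Suc n)) = (char_deg \<nu> / fact n :: 'a)"
      using char_deg_ne_0[of \<mu>, where ?'a = 'a] of_nat_neq_0[of n, where ?'a = 'a]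
      by (simp add: field_simps del: of_nat_Suc)
    then show ?thesis by (simp only: fps_const_mult)
  qed
  finally show ?thesis
    unfolding gh content_weight_def[of _ \<nu>] \<nu>n by (simp only: mult.left_commute)
qed

text \<open>Both sides run over the pairs of partitions of sizes \<open>n\<close> and \<open>n + 1\<close> that differ in one cell.\<close>

lemma sum_cells_above_below:
  "(\<Sum>\<nu>\<in>partitions_of n. \<Sum>(b, \<mu>)\<in>cells_above \<nu>. F \<nu> b \<mu>) =
   (\<Sum>\<mu>\<in>partitions_of (Suc n). \<Sum>(b, \<nu>)\<in>cells_below \<mu>. F \<nu> b \<mu>)"
proof -
  have "(\<Sum>\<nu>\<in>partitions_of n. \<Sum>(b, \<mu>)\<in>cells_above \<nu>. F \<nu> b \<mu>) =
      (\<Sum>(\<nu>, b, \<mu>)\<in>Sigma (partitions_of n) cells_above. F \<nu> b \<mu>)"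
    by (subst sum.Sigma) (auto simp: finite_cells_above)
  also have "\<dots> = (\<Sum>(\<mu>, b, \<nu>)\<in>Sigma (partitions_of (Suc n)) cells_below. F \<nu> b \<mu>)"
    by (rule sum.reindex_bij_witness[of _ "\<lambda>(\<mu>, b, \<nu>). (\<nu>, b, \<mu>)" "\<lambda>(\<nu>, b, \<mu>). (\<mu>, b, \<nu>)"])
       (auto simp: cells_above_def cells_below_def partitions_of_iff adds_cell_sum_list,
        auto simp: adds_cell_def)
  also have "\<dots> = (\<Sum>\<mu>\<in>partitions_of (Suc n). \<Sum>(b, \<nu>)\<in>cells_below \<mu>. F \<nu> b \<mu>)"
    by (subst sum.Sigma) (auto simp: finite_cells_below)
  finally show ?thesis .
qed

section \<open>Solutions of the content equation\<close>

text \<open>Comparing coefficients of \<open>z\<^sup>n\<close> for \<open>n \<ge> 0\<close> gives a recursion; the factor \<open>z\<^sup>-\<^sup>1\<close> adds the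
condition at \<open>z\<^sup>-\<^sup>1\<close>.\<close>

lemma content_pde_iff:
  "content_pde f g \<Psi> \<longleftrightarrow>
     op_series g C_op \<Psi> $ 0 = 0 \<and> (\<forall>n. op_series f U_op \<Psi> $ n = op_series g C_op \<Psi> $ Suc n)"
proof -
  let ?A = "op_series f U_op \<Psi>" and ?B = "op_series g C_op \<Psi>"
  have "content_pde f g \<Psi> \<longleftrightarrow> (\<forall>k. fls_nth (fps_to_fls ?A) k = fls_nth (fps_to_fls ?B) (k + 1))"
    by (simp add: content_pde_def fls_X_inv_times_conv_shift fls_eq_iff)
  also have "\<dots> \<longleftrightarrow> ?B $ 0 = 0 \<and> (\<forall>n. ?A $ n = ?B $ Suc n)" (is "?L \<longleftrightarrow> ?R")
  proof
    assume L: ?L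
    have "?A $ n = ?B $ Suc n" for n
      using L[rule_format, of "int n"] by (simp add: nat_add_distrib)
    moreover have "?B $ 0 = 0" using L[rule_format, of "-1"] by simp
    ultimately show ?R by blast
  next
    assume R: ?R
    show ?L
    proof
      fix k :: int
      \<comment> \<open>the coefficient at \<open>-1\<close> on the left faces the constant term on the right\<close>
      consider "k \<ge> 0" | "k = -1" | "k < -1" by linarith
      then show "fls_nth (fps_to_fls ?A) k = fls_nth (fps_to_fls ?B) (k + 1)"
        using R by cases (auto simp: nat_add_distrib)
    qed
  qed
  finally show ?thesis .
qed

lemma content_series_satisfies_pde:
  fixes f g :: "'a::field_char_0 fps"
  assumes g0: "g $ 0 \<noteq> 0"
  shows "content_pde f g (content_series (f * inverse g))"
  unfolding content_pde_iff
proof (intro conjI allI)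
  show "op_series g C_op (content_series (f * inverse g)) $ 0 = 0"
    by (rule fps_ext) (simp add: op_series_C_nth)
next
  fix n
  show "op_series f U_op (content_series (f * inverse g)) $ n =
      op_series g C_op (content_series (f * inverse g)) $ Suc n"
    unfolding fps_eq_iff op_series_U_nth op_series_C_nth sum_cells_above_below
  proof (intro allI sum.cong refl)
    fix m \<mu> p assume \<mu>: "\<mu> \<in> partitions_of (Suc n)" and p: "p \<in> cells_below \<mu>"
    obtain b \<nu> where p_eq: "p = (b, \<nu>)" and cell: "adds_cell \<nu> b \<mu>"
      using p by (auto simp: cells_below_def)
    have "sum_list \<mu> = Suc n" using \<mu> by (simp add: partitions_of_iff)
    from content_weight_step[OF g0 cell this, of f]
    show "(case p of (b, \<nu>) \<Rightarrow> pm_scale (((f oo (fps_const (of_int (content b)) * fps_X)) *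
            content_weight (f * inverse g) \<nu>) $ m) (schur \<mu>)) =
        (case p of (b, \<nu>) \<Rightarrow> pm_scale ((fps_const (of_nat (Suc n) / char_deg \<mu> * char_deg \<nu>) *
          ((g oo (fps_const (of_int (content b)) * fps_X)) * content_weight (f * inverse g) \<mu>)) $ m) (schur \<mu>))"
      by (simp only: p_eq case_prod_conv)
  qed
qed

lemma content_series_nth_0: "content_series h $ 0 = (1 :: 'a::field_char_0 symfun fps)"
proof (rule fps_ext)
  fix m
  have P: "partitions_of 0 = {[]}"
    using length_partition_le[of _ 0] by (auto simp: partitions_of_def Partitions_def)
  have "content_weight h [] = 1"
    by (simp add: content_weight_def char_deg_Nil diagram_def)
  then show "content_series h $ 0 $ m = (1 :: 'a symfun fps) $ m"
    by (simp add: content_series_nth P schur_Nil)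
qed

lemma const_term_free_content_series: "const_term_free (content_series h)"
proof -
  have "\<nu> \<noteq> []" if "n > 0" "\<nu> \<in> partitions_of n" for n \<nu>
    using that by (auto simp: partitions_of_def)
  then show ?thesis
    by (auto simp: const_term_free_def content_series_nth lookup_sum lookup_schur_0 partitions_of_iff
        intro!: sum.neutral)
qed

text \<open>The coefficient of \<open>y\<^sup>m\<close> of the image is \<open>g\<^sub>0 C\<^sub>0\<close> of the coefficient of \<open>y\<^sup>m\<close> plus terms that involve lower
coefficients only.\<close>

lemma op_series_C_injective:
  fixes g :: "'a::field_char_0 fps"
  assumes g0: "g $ 0 \<noteq> 0"
    and eq: "op_series g C_op \<Psi> $ n = op_series g C_op \<Phi> $ n"
    and free: "\<And>m. Poly_Mapping.lookup (\<Psi> $ n $ m) 0 = 0" "\<And>m. Poly_Mapping.lookup (\<Phi> $ n $ m) 0 = 0"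
  shows "\<Psi> $ n = \<Phi> $ n"
proof (rule fps_ext)
  fix m
  show "\<Psi> $ n $ m = \<Phi> $ n $ m"
  proof (induction m rule: less_induct)
    case (less m)
    let ?s = "\<lambda>\<Psi> i. pm_scale (g $ i) (C_op i (\<Psi> $ n $ (m - i)))"
    have split: "sum F {..m} = F 0 + sum F {1..m}" for F :: "nat \<Rightarrow> 'a symfun"
      by (simp add: atMost_atLeast0 sum.atLeast_Suc_atMost)
    have "?s \<Psi> 0 + (\<Sum>i=1..m. ?s \<Psi> i) = ?s \<Phi> 0 + (\<Sum>i=1..m. ?s \<Phi> i)"
      using arg_cong[OF eq, of "\<lambda>F. F $ m"] unfolding op_series_nth split .
    moreover have "(\<Sum>i=1..m. ?s \<Psi> i) = (\<Sum>i=1..m. ?s \<Phi> i)"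
      using less by (intro sum.cong refl) simp
    ultimately have "C_op 0 (\<Psi> $ n $ m) = C_op 0 (\<Phi> $ n $ m)"
      using g0 by simp
    then have "C_op 0 (\<Psi> $ n $ m - \<Phi> $ n $ m) = 0"
      by (simp add: pmp.linear_diff[OF C_op_linear])
    then have "\<Psi> $ n $ m - \<Phi> $ n $ m = 0"
      by (rule C_op_0_injective) (simp add: lookup_minus free)
    then show ?case by simp
  qed
qed

lemma content_pde_unique:
  fixes f g :: "'a::field_char_0 fps"
  assumes g0: "g $ 0 \<noteq> 0"
    and \<Psi>: "content_pde f g \<Psi>" "const_term_free \<Psi>"
    and \<Phi>: "content_pde f g \<Phi>" "const_term_free \<Phi>"
    and init: "\<Psi> $ 0 = \<Phi> $ 0"
  shows "\<Psi> = \<Phi>"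
proof (rule fps_ext)
  fix n
  show "\<Psi> $ n = \<Phi> $ n"
  proof (induction n)
    case (Suc n)
    have "op_series f U_op \<Psi> $ n = op_series f U_op \<Phi> $ n"
      by (rule fps_ext) (simp add: op_series_nth Suc.IH)
    then have "op_series g C_op \<Psi> $ Suc n = op_series g C_op \<Phi> $ Suc n"
      using \<Psi>(1) \<Phi>(1) by (simp add: content_pde_iff)
    then show ?case
    proof (rule op_series_C_injective[OF g0])
      show "Poly_Mapping.lookup (\<Psi> $ Suc n $ m) 0 = 0" "Poly_Mapping.lookup (\<Phi> $ Suc n $ m) 0 = 0" for m
        using \<Psi>(2) \<Phi>(2) unfolding const_term_free_def by blast+
    qed
  qed (rule init)
qed

theorem theorem2p1:
  fixes f g :: "'a::field_char_0 fps"
  assumes "g $ 0 \<noteq> 0"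
  shows "content_pde f g (content_series (f * inverse g)) \<and>
         content_series (f * inverse g) $ 0 = 1 \<and>
         const_term_free (content_series (f * inverse g)) \<and>
         (\<forall>\<Psi>. content_pde f g \<Psi> \<and> \<Psi> $ 0 = 1 \<and> const_term_free \<Psi> \<longrightarrow>
              \<Psi> = content_series (f * inverse g))"
proof (intro conjI allI impI)
  let ?\<Phi> = "content_series (f * inverse g)"
  show pde: "content_pde f g ?\<Phi>" using assms by (rule content_series_satisfies_pde)
  show init: "?\<Phi> $ 0 = 1" by (rule content_series_nth_0)
  show free: "const_term_free ?\<Phi>" by (rule const_term_free_content_series)
  fix \<Psi> assume "content_pde f g \<Psi> \<and> \<Psi> $ 0 = 1 \<and> const_term_free \<Psi>"
  then show "\<Psi> = ?\<Phi>"
    using pde init free by (intro content_pde_unique[OF assms, of f \<Psi> ?\<Phi>]) simp_all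
qed

end
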